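(* For every $\lambda\in\Lambda(d)$, $$s^+_{M_\lambda}=\chi_{-\lambda}\qquad\text{and}\qquad s^-_{M_\lambda}=\chi_{(0,1)-\lambda}$$ as maps $\mathrm{Gr}(D(B))\to\mathbb{C}$.
   Context: Fix an integer $d\ge 2$ and a primitive $d$-th root of unity $\zeta\in\mathbb{C}$. Notation: $(n)_\xi=1+\xi+\cdots+\xi^{n-1}$, $(n)!_\xi=\prod_{i=1}^n(i)_\xi$, $(0)!_\xi=1$. $D(B)$ (the Drinfeld double of the Taft algebra) is the $\mathbb{C}$-algebra with generators $E,F,K,z$ and relations $K^d=z^d=1$, $E^d=F^d=0$, $z$ central, $KE=\zeta EK$, $KF=\zeta^{-1}FK$, $[E,F]=K-zK^{-1}$. It is a Hopf algebra with $\Delta(K)=K\otimes K$, $\Delta(z)=z\otimes z$, $\Delta(E)=1\otimes E+E\otimes K$, $\Delta(F)=F\otimes 1+zK^{-1}\otimes F$, $\varepsilon(K)=\varepsilon(z)=1$, $\varepsilon(E)=\varepsilon(F)=0$, $S(K)=K^{-1}$, $S(z)=z^{-1}$, $S(E)=-EK^{-1}$, $S(F)=-\zeta^{-1}FKz^{-1}$. It has the universal $R$-matrix $$R=\frac1d\sum_{i,j,k=0}^{d-1}\frac{\zeta^{(i-k)(i+j)-i(i+1)/2}}{(i)!_\zeta}E^iK^j\otimes z^{-k}F^iK^k.$$ Modules are finite-dimensional left modules. With $\tau(a\otimes b)=b\otimes a$, the braiding is $c_{M,N}(m\otimes n)=\tau(R)(n\otimes m)$, so $c_{N,M}c_{M,N}$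 is the action of $\tau(R)R$ on $M\otimes N$. The pivot is $z^{-1}K$: the quantum traces of $f\in\mathrm{End}_{D(B)}(M)$ are $\mathrm{Tr}_+^M(f)=\mathrm{trace}(z^{-1}Kf)$ and $\mathrm{Tr}_-^M(f)=\mathrm{trace}(fK^{-1}z)$ (ordinary traces). $\Lambda(d)=\mathbb{Z}/d\mathbb{Z}\times\mathbb{Z}/d\mathbb{Z}$ is identified with $\{1,\dots,d\}\times\mathbb{Z}/d\mathbb{Z}$. For $\lambda=(l,p)$ with $1\le l\le d$, $M_\lambda=M_{l,p}$ is the simple module with basis $e_1,\dots,e_l$, $z=\zeta^{2p+l-1}\mathrm{Id}$, $Ke_i=\zeta^{p+l-i}e_i$, $Fe_i=e_{i+1}$ ($Fe_l=0$), $Ee_1=0$, $Ee_{i+1}=\zeta^p(i)_\zeta(\zeta^{l-i}-1)e_i$. $\mathrm{Gr}(D(B))$ is the Grothendieck ring of $D(B)$-modules. For $(i,j)\in\Lambda(d)$, $\chi_{i,j}([M])=\mathrm{trace}(K^iz^j|_M)$. For $\lambda\in\Lambda(d)$, $s^+_{M_\lambda}([M])$ is the scalar by which the endomorphism $(\mathrm{Id}_{M_\lambda}\otimes\mathrm{Tr}_+^M)(c_{M,M_\lambda}c_{M_\lambda,M})$ of the simple module $M_\lambda$ acts, where $\mathrm{Id}_{M_\lambda}\otimes\mathrm{Tr}_+^M$ is the partial quantum trace over $M$ of an endomorphism of $M_\lambda\otimes M$ (i.e. compose with $1\otimes z^{-1}K$ and take the ordinary partial trace over $M$). Likewise $s^-_{M_\lambda}([M])$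 is the scalar by which $(\mathrm{Tr}_-^M\otimes\mathrm{Id}_{M_\lambda})(c_{M_\lambda,M}c_{M,M_\lambda})$ acts on $M_\lambda$ (partial trace over $M$ of an endomorphism of $M\otimes M_\lambda$ composed with $K^{-1}z\otimes1$). *)

theory Defs
  imports
    "HOL-Library.Product_Plus"
    "HOL-Algebra.Free_Abelian_Groups"
    "Jordan_Normal_Form.Matrix"
begin

section \<open>Roots of unity and quantum factorials\<close>

definition primitive_root_unity :: "nat \<Rightarrow> complex \<Rightarrow> bool" where
  "primitive_root_unity d \<zeta> \<longleftrightarrow> \<zeta> ^ d = 1 \<and> (\<forall>k. 0 < k \<and> k < d \<longrightarrow> \<zeta> ^ k \<noteq> 1)"

definition qint :: "complex \<Rightarrow> nat \<Rightarrow> complex" where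
  "qint \<xi> n = (\<Sum>i<n. \<xi> ^ i)"

definition qfact :: "complex \<Rightarrow> nat \<Rightarrow> complex" where
  "qfact \<xi> n = (\<Prod>i=1..n. qint \<xi> i)"


section \<open>Matrices\<close>

definition mat_trace :: "complex mat \<Rightarrow> complex" where
  "mat_trace A = (\<Sum>i<dim_row A. A $$ (i, i))"

text \<open>
  The tensor product of \<open>\<complex>\<^sup>m\<close> and \<open>\<complex>\<^sup>n\<close> is identified with \<open>\<complex>\<^sup>m\<^sup>n\<close> by letting the index
  \<open>i * n + j\<close> (with \<open>i < m\<close>, \<open>j < n\<close>, counting from 0) stand for the tensor product of the
  \<open>i\<close>-th and the \<open>j\<close>-th basis vector.
\<close>

definition kron :: "complex mat \<Rightarrow> complex mat \<Rightarrow> complex mat" where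
  "kron A B = mat (dim_row A * dim_row B) (dim_col A * dim_col B)
     (\<lambda>(r, c). A $$ (r div dim_row B, c div dim_col B) * B $$ (r mod dim_row B, c mod dim_col B))"

text \<open>The map sending \<open>x \<otimes> y\<close> to \<open>y \<otimes> x\<close>, where \<open>x \<in> \<complex>\<^sup>m\<close> and \<open>y \<in> \<complex>\<^sup>n\<close>.\<close>

definition flip_mat :: "nat \<Rightarrow> nat \<Rightarrow> complex mat" where
  "flip_mat m n = mat (n * m) (m * n)
     (\<lambda>(r, c). if r div m = c mod n \<and> r mod m = c div n then 1 else 0)"

text \<open>Ordinary partial traces of an endomorphism of \<open>\<complex>\<^sup>m \<otimes> \<complex>\<^sup>n\<close>, over the left factor
  (the result acts on \<open>\<complex>\<^sup>n\<close>) and over the right factor (the result acts on \<open>\<complex>\<^sup>m\<close>).\<close>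

definition ptrace_left :: "nat \<Rightarrow> nat \<Rightarrow> complex mat \<Rightarrow> complex mat" where
  "ptrace_left m n A = mat n n (\<lambda>(r, c). \<Sum>i<m. A $$ (i * n + r, i * n + c))"

definition ptrace_right :: "nat \<Rightarrow> nat \<Rightarrow> complex mat \<Rightarrow> complex mat" where
  "ptrace_right m n A = mat m m (\<lambda>(r, c). \<Sum>j<n. A $$ (r * n + j, c * n + j))"

text \<open>Powers with exponent in \<open>\<int>/d\<int>\<close> of a matrix with \<open>A\<^sup>d = 1\<close>; in particular
  \<open>zpow d A (-1)\<close> is the inverse of such a matrix.\<close>

definition zpow :: "nat \<Rightarrow> complex mat \<Rightarrow> int \<Rightarrow> complex mat" where
  "zpow d A k = A ^\<^sub>m nat (k mod int d)"

definition scalar_of :: "complex mat \<Rightarrow> complex" where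
  "scalar_of A = (THE c. A = c \<cdot>\<^sub>m 1\<^sub>m (dim_row A))"


section \<open>Modules over the Drinfeld double of the Taft algebra\<close>

text \<open>
  The algebra \<open>D(B)\<close> is presented by generators \<open>E, F, K, z\<close> and relations. A left \<open>D(B)\<close>-module
  structure on \<open>\<complex>\<^sup>n\<close> therefore is a quadruple of matrices satisfying the relations.
  Every finite-dimensional module is isomorphic to one of this form, and the modules on the
  spaces \<open>\<complex>\<^sup>n\<close> form a set.
\<close>

record db_module =
  mdim :: nat
  actE :: "complex mat"
  actF :: "complex mat"
  actK :: "complex mat"
  actZ :: "complex mat"

definition db_modules :: "nat \<Rightarrow> complex \<Rightarrow> db_module set" where
  "db_modules d \<zeta> = {M.
     let n = mdim M; E = actE M; F = actF M; K = actK M; z = actZ M in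
       E \<in> carrier_mat n n \<and> F \<in> carrier_mat n n \<and> K \<in> carrier_mat n n \<and> z \<in> carrier_mat n n \<and>
       K ^\<^sub>m d = 1\<^sub>m n \<and> z ^\<^sub>m d = 1\<^sub>m n \<and> E ^\<^sub>m d = 0\<^sub>m n n \<and> F ^\<^sub>m d = 0\<^sub>m n n \<and>
       z * E = E * z \<and> z * F = F * z \<and> z * K = K * z \<and>
       K * E = \<zeta> \<cdot>\<^sub>m (E * K) \<and> K * F = inverse \<zeta> \<cdot>\<^sub>m (F * K) \<and>
       E * F - F * E = K - z * zpow d K (-1)}"

text \<open>The module structures given by the counit and by the coproduct.\<close>

definition db_unit :: db_module where
  "db_unit = \<lparr>mdim = 1, actE = 0\<^sub>m 1 1, actF = 0\<^sub>m 1 1, actK = 1\<^sub>m 1, actZ = 1\<^sub>m 1\<rparr>"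

definition db_tensor :: "nat \<Rightarrow> db_module \<Rightarrow> db_module \<Rightarrow> db_module" where
  "db_tensor d M N =
     \<lparr>mdim = mdim M * mdim N,
      actE = kron (1\<^sub>m (mdim M)) (actE N) + kron (actE M) (actK N),
      actF = kron (actF M) (1\<^sub>m (mdim N)) + kron (actZ M * zpow d (actK M) (-1)) (actF N),
      actK = kron (actK M) (actK N),
      actZ = kron (actZ M) (actZ N)\<rparr>"

definition db_hom :: "db_module \<Rightarrow> db_module \<Rightarrow> complex mat \<Rightarrow> bool" where
  "db_hom M N A \<longleftrightarrow> A \<in> carrier_mat (mdim N) (mdim M) \<and>
     A * actE M = actE N * A \<and> A * actF M = actF N * A \<and>
     A * actK M = actK N * A \<and> A * actZ M = actZ N * A"

text \<open>There is a short exact sequence \<open>0 \<rightarrow> M' \<rightarrow> M \<rightarrow> M'' \<rightarrow> 0\<close>.\<close>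

definition db_short_exact :: "nat \<Rightarrow> complex \<Rightarrow> db_module \<Rightarrow> db_module \<Rightarrow> db_module \<Rightarrow> bool" where
  "db_short_exact d \<zeta> M' M M'' \<longleftrightarrow>
     M' \<in> db_modules d \<zeta> \<and> M \<in> db_modules d \<zeta> \<and> M'' \<in> db_modules d \<zeta> \<and>
     (\<exists>A B. db_hom M' M A \<and> db_hom M M'' B \<and>
        inj_on (\<lambda>v. A *\<^sub>v v) (carrier_vec (mdim M')) \<and>
        (\<lambda>v. A *\<^sub>v v) ` carrier_vec (mdim M') = {v \<in> carrier_vec (mdim M). B *\<^sub>v v = 0\<^sub>v (mdim M'')} \<and>
        (\<lambda>v. B *\<^sub>v v) ` carrier_vec (mdim M) = carrier_vec (mdim M''))"

text \<open>
  The index set \<open>\<Lambda>(d)\<close>: pairs of residue classes mod \<open>d\<close>, represented by integers, the first one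
  in \<open>{1, \<dots>, d}\<close>. The basis vector \<open>e\<^sub>i\<close> of \<open>M\<^sub>\<lambda>\<close> has index \<open>i - 1\<close>.
\<close>

definition Lambda :: "nat \<Rightarrow> (int \<times> int) set" where
  "Lambda d = {1..int d} \<times> {0..<int d}"

definition simple_module :: "complex \<Rightarrow> int \<times> int \<Rightarrow> db_module" where
  "simple_module \<zeta> lam = (case lam of (l, p) \<Rightarrow> let n = nat l in
     \<lparr>mdim = n,
      actE = mat n n (\<lambda>(r, c). if c = Suc r
               then \<zeta> powi p * qint \<zeta> c * (\<zeta> powi (l - int c) - 1) else 0),
      actF = mat n n (\<lambda>(r, c). if r = Suc c then 1 else 0),
      actK = mat n n (\<lambda>(r, c). if r = c then \<zeta> powi (p + l - int (Suc c)) else 0),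
      actZ = \<zeta> powi (2 * p + l - 1) \<cdot>\<^sub>m 1\<^sub>m n\<rparr>)"


section \<open>Braiding and quantum traces\<close>

text \<open>The \<open>R\<close>-matrix is the sum of the terms \<open>R_coeff d \<zeta> i j k\<close> times
  \<open>E\<^sup>iK\<^sup>j \<otimes> z\<^sup>-\<^sup>kF\<^sup>iK\<^sup>k\<close> over \<open>0 \<le> i, j, k < d\<close>.\<close>

definition R_coeff :: "nat \<Rightarrow> complex \<Rightarrow> nat \<Rightarrow> nat \<Rightarrow> nat \<Rightarrow> complex" where
  "R_coeff d \<zeta> i j k =
     1 / of_nat d *
     (\<zeta> powi ((int i - int k) * (int i + int j) - int i * (int i + 1) div 2) / qfact \<zeta> i)"

definition R_left :: "db_module \<Rightarrow> nat \<Rightarrow> nat \<Rightarrow> complex mat" where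
  "R_left M i j = actE M ^\<^sub>m i * actK M ^\<^sub>m j"

definition R_right :: "nat \<Rightarrow> db_module \<Rightarrow> nat \<Rightarrow> nat \<Rightarrow> complex mat" where
  "R_right d M i k = zpow d (actZ M) (- int k) * actF M ^\<^sub>m i * actK M ^\<^sub>m k"

text \<open>The action of \<open>\<tau>(R)\<close> on \<open>N \<otimes> M\<close>.\<close>

definition tau_R :: "nat \<Rightarrow> complex \<Rightarrow> db_module \<Rightarrow> db_module \<Rightarrow> complex mat" where
  "tau_R d \<zeta> N M = mat (mdim N * mdim M) (mdim N * mdim M)
     (\<lambda>rc. \<Sum>i<d. \<Sum>j<d. \<Sum>k<d. R_coeff d \<zeta> i j k * kron (R_right d N i k) (R_left M i j) $$ rc)"

text \<open>The braiding \<open>c\<^sub>M\<^sub>,\<^sub>N : M \<otimes> N \<rightarrow> N \<otimes> M\<close>.\<close>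

definition braiding :: "nat \<Rightarrow> complex \<Rightarrow> db_module \<Rightarrow> db_module \<Rightarrow> complex mat" where
  "braiding d \<zeta> M N = tau_R d \<zeta> N M * flip_mat (mdim M) (mdim N)"

definition pivot :: "nat \<Rightarrow> db_module \<Rightarrow> complex mat" where
  "pivot d M = zpow d (actZ M) (-1) * actK M"

definition pivot_inv :: "nat \<Rightarrow> db_module \<Rightarrow> complex mat" where
  "pivot_inv d M = zpow d (actK M) (-1) * actZ M"

text \<open>For an endomorphism \<open>f\<close> of \<open>L \<otimes> M\<close> resp. \<open>M \<otimes> L\<close>, the partial quantum traces
  \<open>(Id\<^sub>L \<otimes> Tr\<^sub>+\<^sup>M)(f)\<close> resp. \<open>(Tr\<^sub>-\<^sup>M \<otimes> Id\<^sub>L)(f)\<close>.\<close>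

definition qtrace_plus_right :: "nat \<Rightarrow> db_module \<Rightarrow> db_module \<Rightarrow> complex mat \<Rightarrow> complex mat" where
  "qtrace_plus_right d L M f =
     ptrace_right (mdim L) (mdim M) (kron (1\<^sub>m (mdim L)) (pivot d M) * f)"

definition qtrace_minus_left :: "nat \<Rightarrow> db_module \<Rightarrow> db_module \<Rightarrow> complex mat \<Rightarrow> complex mat" where
  "qtrace_minus_left d M L f =
     ptrace_left (mdim M) (mdim L) (f * kron (pivot_inv d M) (1\<^sub>m (mdim L)))"


section \<open>The Grothendieck ring\<close>

definition Gr_relations :: "nat \<Rightarrow> complex \<Rightarrow> (db_module \<Rightarrow>\<^sub>0 int) set" where
  "Gr_relations d \<zeta> = generate (free_Abelian_group (db_modules d \<zeta>))
     {frag_of M - frag_of M' - frag_of M'' | M' M M''. db_short_exact d \<zeta> M' M M''}"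

definition Gr_coset :: "nat \<Rightarrow> complex \<Rightarrow> (db_module \<Rightarrow>\<^sub>0 int) \<Rightarrow> (db_module \<Rightarrow>\<^sub>0 int) set" where
  "Gr_coset d \<zeta> a = Gr_relations d \<zeta> #>\<^bsub>free_Abelian_group (db_modules d \<zeta>)\<^esub> a"

definition Gr :: "nat \<Rightarrow> complex \<Rightarrow> (db_module \<Rightarrow>\<^sub>0 int) set ring" where
  "Gr d \<zeta> = (let Q = free_Abelian_group (db_modules d \<zeta>) Mod Gr_relations d \<zeta> in
     \<lparr>carrier = carrier Q,
      monoid.mult = (\<lambda>X Y. \<Union>a\<in>X. \<Union>b\<in>Y. Gr_coset d \<zeta>
                (frag_extend (\<lambda>M. frag_extend (\<lambda>N. frag_of (db_tensor d M N)) b) a)),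
      one = Gr_coset d \<zeta> (frag_of db_unit),
      zero = \<one>\<^bsub>Q\<^esub>,
      add = monoid.mult Q\<rparr>)"

text \<open>
  A function \<open>\<phi>\<close> on modules extends linearly to the free abelian group on modules; it is
  well-defined on \<open>Gr(D(B))\<close> if this extension is constant on cosets, and then induces the map
  \<open>[M] \<mapsto> \<phi> M\<close> on \<open>Gr(D(B))\<close>.
\<close>

definition frag_eval :: "(db_module \<Rightarrow> complex) \<Rightarrow> (db_module \<Rightarrow>\<^sub>0 int) \<Rightarrow> complex" where
  "frag_eval \<phi> a = (\<Sum>M\<in>Poly_Mapping.keys a. of_int (Poly_Mapping.lookup a M) * \<phi> M)"

definition Gr_well_defined :: "nat \<Rightarrow> complex \<Rightarrow> (db_module \<Rightarrow> complex) \<Rightarrow> bool" where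
  "Gr_well_defined d \<zeta> \<phi> \<longleftrightarrow>
     (\<forall>X\<in>carrier (Gr d \<zeta>). \<forall>a\<in>X. \<forall>b\<in>X. frag_eval \<phi> a = frag_eval \<phi> b)"

definition Gr_map :: "nat \<Rightarrow> complex \<Rightarrow> (db_module \<Rightarrow> complex) \<Rightarrow> (db_module \<Rightarrow>\<^sub>0 int) set \<Rightarrow> complex"
  where "Gr_map d \<zeta> \<phi> = (\<lambda>X\<in>carrier (Gr d \<zeta>). THE c. \<forall>a\<in>X. frag_eval \<phi> a = c)"

text \<open>The following three families are given first on modules, then on \<open>Gr(D(B))\<close>.\<close>

definition chi_module :: "nat \<Rightarrow> int \<times> int \<Rightarrow> db_module \<Rightarrow> complex" where
  "chi_module d = (\<lambda>(i, j) M. mat_trace (zpow d (actK M) i * zpow d (actZ M) j))"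

definition s_plus_module :: "nat \<Rightarrow> complex \<Rightarrow> int \<times> int \<Rightarrow> db_module \<Rightarrow> complex" where
  "s_plus_module d \<zeta> lam M = (let L = simple_module \<zeta> lam in
     scalar_of (qtrace_plus_right d L M (braiding d \<zeta> M L * braiding d \<zeta> L M)))"

definition s_minus_module :: "nat \<Rightarrow> complex \<Rightarrow> int \<times> int \<Rightarrow> db_module \<Rightarrow> complex" where
  "s_minus_module d \<zeta> lam M = (let L = simple_module \<zeta> lam in
     scalar_of (qtrace_minus_left d M L (braiding d \<zeta> L M * braiding d \<zeta> M L)))"

definition chi :: "nat \<Rightarrow> complex \<Rightarrow> int \<times> int \<Rightarrow> (db_module \<Rightarrow>\<^sub>0 int) set \<Rightarrow> complex" where
  "chi d \<zeta> ij = Gr_map d \<zeta> (chi_module d ij)"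

definition s_plus :: "nat \<Rightarrow> complex \<Rightarrow> int \<times> int \<Rightarrow> (db_module \<Rightarrow>\<^sub>0 int) set \<Rightarrow> complex" where
  "s_plus d \<zeta> lam = Gr_map d \<zeta> (s_plus_module d \<zeta> lam)"

definition s_minus :: "nat \<Rightarrow> complex \<Rightarrow> int \<times> int \<Rightarrow> (db_module \<Rightarrow>\<^sub>0 int) set \<Rightarrow> complex" where
  "s_minus d \<zeta> lam = Gr_map d \<zeta> (s_minus_module d \<zeta> lam)"

end

theory Submission
  imports Defs
begin

text \<open>
  Summing over the Cartan part of the \<open>R\<close>-matrix by Fourier inversion, the partial quantum trace of
  the double braiding over \<open>M\<close> becomes a diagonal operator on \<open>M\<^sub>\<lambda>\<close>, because traces on \<open>M\<close> of words
  of nonzero \<open>K\<close>-degree vanish. Its entry at a vector of weight \<open>a\<close> is a sum over \<open>i < d\<close> of an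
  eigenvalue of \<open>F\<^sup>iE\<^sup>i\<close> (or \<open>E\<^sup>iF\<^sup>i\<close>) times a trace on \<open>M\<close>. Moving one \<open>E\<close> or \<open>F\<close> cyclically around that
  trace relates the traces for \<open>i\<close> and \<open>i + 1\<close>, so that the difference of two neighbouring entries
  telescopes to \<open>0\<close>: no property of the \<open>R\<close>-matrix is needed to see that the operator is a scalar.
  At an extremal vector only \<open>i = 0\<close> survives. This gives \<open>\<chi>\<^bsub>(0,1)-\<lambda>\<^esub>\<close> for the minus sign and
  \<open>trace(K\<^sup>lz\<^sup>-\<^sup>p\<^sup>-\<^sup>l)\<close> for the plus sign, which equals \<open>trace(K\<^sup>-\<^sup>lz\<^sup>-\<^sup>p)\<close> on every module. The characters
  are additive on short exact sequences, hence so are the scalars.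
\<close>

section \<open>Roots of unity\<close>

text \<open>On a weight vector of \<open>M\<^sub>\<lambda>\<close> the Cartan factors are powers of
  \<zeta>. Two of the four Cartan exponents of the double braiding therefore occur only in
  characters of Z/d; summing over them fixes the other two, the powers of \<open>K\<close> seen by
  \<open>M\<close>. The plus sign leads to \<open>F^i E^i\<close> on
  \<open>M\<^sub>\<lambda>\<close>, which kills the highest weight vector for i > 0, the minus sign
  to \<open>E^i F^i\<close>, which kills the lowest one; this is why the two signs end at different
  words in \<open>K\<close> and \<open>z\<close> and why plus is followed by a reflection. That
  reflection cannot be read off from weights, because \<open>M\<close> is in general neither simple
  nor semisimple. Instead the Casimir element gives a three-term recursion for traces
  \<open>tr (A K^a z^c)\<close>, with \<open>A\<close> an endomorphism of \<open>M\<close>, and this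
  recursion is symmetric under the exchange of \<open>K\<close> and \<open>z K^(-1)\<close>.
  Matrices carry their sizes and form no ring as a type. The relations of the algebra are therefore
  mostly applied inside \<open>tr (X * ... * Y)\<close> with arbitrary \<open>X\<close> and
  \<open>Y\<close>: scalars become complex factors and words stay associated to the right.\<close>

lemma primitive_root_nonzero:
  assumes "primitive_root_unity d \<zeta>" "d > 0" shows "\<zeta> \<noteq> 0"
  using assms by (auto simp: primitive_root_unity_def power_0_left split: if_splits)

lemma root_unity_powi_mod:
  fixes \<zeta> :: complex
  assumes "\<zeta> ^ d = 1" "d > 0"
  shows "\<zeta> powi (k mod int d) = \<zeta> powi k"
proof -
  have nz: "\<zeta> \<noteq> 0" using assms by (auto simp: power_0_left split: if_splits)
  have "\<zeta> powi k = \<zeta> powi (int d * (k div int d) + k mod int d)" by simp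
  also have "\<dots> = \<zeta> powi (int d * (k div int d)) * \<zeta> powi (k mod int d)"
    by (rule power_int_add) (use nz in simp)
  also have "\<zeta> powi (int d * (k div int d)) = 1"
    using assms by (simp add: power_int_mult)
  finally show ?thesis by simp
qed

lemma primitive_root_powi_eq_1_iff:
  assumes "primitive_root_unity d \<zeta>" "d > 0"
  shows "\<zeta> powi k = 1 \<longleftrightarrow> int d dvd k"
proof -
  have 1: "\<zeta> ^ d = 1" using assms by (simp add: primitive_root_unity_def)
  define m where "m = nat (k mod int d)"
  have m: "int m = k mod int d" "m < d" using assms by (auto simp: m_def nat_less_iff)
  have "\<zeta> powi k = \<zeta> ^ m"
    using root_unity_powi_mod[OF 1 assms(2), of k] m by (metis power_int_of_nat)
  also have "\<zeta> ^ m = 1 \<longleftrightarrow> m = 0"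
    using assms m(2) unfolding primitive_root_unity_def by (metis gr0I power_0)
  also have "m = 0 \<longleftrightarrow> int d dvd k" using m by (auto simp: dvd_eq_mod_eq_0)
  finally show ?thesis .
qed

lemma qint_eq:
  assumes "\<zeta> \<noteq> 1" shows "qint \<zeta> n = (\<zeta> ^ n - 1) / (\<zeta> - 1)"
  using assms by (simp add: qint_def geometric_sum)

lemma qfact_Suc: "qfact \<zeta> (Suc n) = qint \<zeta> (Suc n) * qfact \<zeta> n"
  by (simp add: qfact_def mult.commute)

lemma qfact_0 [simp]: "qfact \<zeta> 0 = 1"
  by (simp add: qfact_def)

lemma primitive_root_qint_nonzero:
  assumes "primitive_root_unity d \<zeta>" "0 < n" "n < d"
  shows "qint \<zeta> n \<noteq> 0"
proof -
  have "\<zeta> \<noteq> 1" using assms by (auto simp: primitive_root_unity_def dest: spec[of _ 1])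
  moreover have "\<zeta> ^ n \<noteq> 1" using assms by (auto simp: primitive_root_unity_def)
  ultimately show ?thesis by (simp add: qint_eq)
qed

lemma root_unity_powi_sum:
  assumes "primitive_root_unity d \<zeta>" "d > 0"
  shows "(\<Sum>k<d. \<zeta> powi (int k * u)) = (if int d dvd u then of_nat d else 0)"
proof -
  have nz: "\<zeta> \<noteq> 0" using primitive_root_nonzero assms by blast
  have e: "(\<Sum>k<d. \<zeta> powi (int k * u)) = (\<Sum>k<d. (\<zeta> powi u) ^ k)"
    by (simp add: power_int_mult mult.commute[of _ u])
  show ?thesis
  proof (cases "int d dvd u")
    case True
    then have "\<zeta> powi u = 1" using primitive_root_powi_eq_1_iff[OF assms] by blast
    then show ?thesis using e True by simp
  next
    case False
    have "(\<zeta> powi u) ^ d = (\<zeta> ^ d) powi u"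
      by (metis mult.commute power_int_mult power_int_of_nat)
    also have "\<dots> = 1" using assms by (simp add: primitive_root_unity_def)
    finally show ?thesis
      using False e primitive_root_powi_eq_1_iff[OF assms] by (simp add: geometric_sum)
  qed
qed

text \<open>Orthogonality of the characters of Z/d: the sum over \<open>k\<close> selects the
  \<open>j\<close> congruent to \<open>u\<close>. Periodicity of \<open>f\<close> admits any integer
  \<open>u\<close>, such as a difference of weights, as point of evaluation.\<close>

lemma fourier_inversion:
  fixes f :: "int \<Rightarrow> complex"
  assumes "primitive_root_unity d \<zeta>" "d > 0" and f: "\<And>x. f (x mod int d) = f x"
  shows "(\<Sum>j<d. \<Sum>k<d. \<zeta> powi (int k * (u - int j)) * f (int j)) = of_nat d * f u"
proof -
  define m where "m = nat (u mod int d)"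
  have m: "int m = u mod int d" "m < d" using assms by (auto simp: m_def nat_less_iff)
  have "(\<Sum>j<d. \<Sum>k<d. \<zeta> powi (int k * (u - int j)) * f (int j))
      = (\<Sum>j<d. if j = m then of_nat d * f u else 0)"
  proof (rule sum.cong)
    fix j assume "j \<in> {..<d}"
    then have "int d dvd u - int j \<longleftrightarrow> j = m"
      using m by (auto simp: mod_eq_dvd_iff [symmetric])
    then show "(\<Sum>k<d. \<zeta> powi (int k * (u - int j)) * f (int j))
        = (if j = m then of_nat d * f u else 0)"
      using root_unity_powi_sum[OF assms(1,2), of "u - int j"] f[of u] m
      by (simp add: sum_distrib_right [symmetric])
  qed simp
  then show ?thesis using m by simp
qed

text \<open>By \<open>step\<close>, the first \<open>n\<close> differences of summands add up to one
  boundary term at \<open>n - 1\<close>, which vanishes for \<open>n = d\<close> because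
  \<open>\<Phi> (d - 1) = 0\<close>. Primed and unprimed data will belong to two neighbouring basis
  vectors of the simple module.\<close>

lemma sum_telescope_shift:
  fixes \<gamma> \<Phi> \<Phi>' T T' :: "nat \<Rightarrow> complex"
  assumes "0 < d" "\<Phi>' 0 = \<Phi> 0" "\<Phi> (d - 1) = 0"
    and step: "\<And>i. Suc i < d \<Longrightarrow>
      \<gamma> (Suc i) * (\<Phi>' (Suc i) - \<Phi> (Suc i)) * T' (Suc i) = \<gamma> i * \<Phi> i * (T i - T' i)"
  shows "(\<Sum>i<d. \<gamma> i * \<Phi>' i * T' i) = (\<Sum>i<d. \<gamma> i * \<Phi> i * T i)"
proof -
  have "(\<Sum>i<n. \<gamma> i * \<Phi>' i * T' i - \<gamma> i * \<Phi> i * T i)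
      = (if n = 0 then 0 else - \<gamma> (n - 1) * \<Phi> (n - 1) * (T (n - 1) - T' (n - 1)))"
    if "n \<le> d" for n
    using that
  proof (induction n)
    case (Suc n)
    show ?case
    proof (cases n)
      case 0
      then show ?thesis using assms(2) by (simp add: algebra_simps)
    next
      case (Suc m)
      then show ?thesis using Suc.IH Suc.prems step[of m] by (simp add: algebra_simps)
    qed
  qed simp
  from this[of d] show ?thesis using assms by (simp add: sum_subtractf)
qed

section \<open>Traces and powers of matrices\<close>

lemma mat_trace_comm:
  assumes "A \<in> carrier_mat n m" "B \<in> carrier_mat m n"
  shows "mat_trace (A * B) = mat_trace (B * A)"
proof -
  have "mat_trace (A * B) = (\<Sum>i<n. \<Sum>j<m. A $$ (i, j) * B $$ (j, i))"
    using assms by (auto simp: mat_trace_def scalar_prod_def lessThan_atLeast0 intro!: sum.cong)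
  also have "\<dots> = (\<Sum>j<m. \<Sum>i<n. B $$ (j, i) * A $$ (i, j))"
    by (subst sum.swap) (simp add: mult.commute)
  also have "\<dots> = mat_trace (B * A)"
    using assms by (auto simp: mat_trace_def scalar_prod_def lessThan_atLeast0 intro!: sum.cong)
  finally show ?thesis .
qed

lemma mat_trace_add:
  "A \<in> carrier_mat n n \<Longrightarrow> B \<in> carrier_mat n n \<Longrightarrow> mat_trace (A + B) = mat_trace A + mat_trace B"
  by (auto simp: mat_trace_def sum.distrib)

lemma mat_trace_minus:
  "A \<in> carrier_mat n n \<Longrightarrow> B \<in> carrier_mat n n \<Longrightarrow> mat_trace (A - B) = mat_trace A - mat_trace B"
  by (auto simp: mat_trace_def sum_subtractf)

lemma mat_trace_smult:
  "A \<in> carrier_mat n n \<Longrightarrow> mat_trace (c \<cdot>\<^sub>m A) = c * mat_trace A"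
  by (auto simp: mat_trace_def sum_distrib_left)

lemma pow_mat_add:
  assumes "A \<in> carrier_mat n n"
  shows "A ^\<^sub>m (j + k) = A ^\<^sub>m j * A ^\<^sub>m k"
  using assms by (induction k) (auto simp: assoc_mult_mat[of _ n n _ n _ n])

lemma pow_mat_Suc_left:
  assumes "A \<in> carrier_mat n n"
  shows "A ^\<^sub>m Suc k = A * A ^\<^sub>m k"
  using pow_mat_add[OF assms, of 1 k] assms by simp

lemma pow_mat_mult_one:
  assumes "A \<in> carrier_mat n n" "A ^\<^sub>m d = 1\<^sub>m n"
  shows "A ^\<^sub>m (d * q) = 1\<^sub>m n"
  using assms by (induction q) (auto simp: pow_mat_add)

lemma pow_mat_mod:
  assumes "A \<in> carrier_mat n n" "A ^\<^sub>m d = 1\<^sub>m n"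
  shows "A ^\<^sub>m (k mod d) = A ^\<^sub>m k"
proof -
  have "A ^\<^sub>m k = A ^\<^sub>m (d * (k div d) + k mod d)" by simp
  also have "\<dots> = A ^\<^sub>m (k mod d)" using assms by (simp only: pow_mat_add pow_mat_mult_one) simp
  finally show ?thesis by simp
qed

lemma zpow_carrier [simp]: "A \<in> carrier_mat n n \<Longrightarrow> zpow d A k \<in> carrier_mat n n"
  by (simp add: zpow_def)

lemma zpow_mod [simp]: "zpow d A (k mod int d) = zpow d A k"
  by (simp add: zpow_def)

lemma zpow_of_nat:
  assumes "A \<in> carrier_mat n n" "A ^\<^sub>m d = 1\<^sub>m n"
  shows "zpow d A (int k) = A ^\<^sub>m k"
  using pow_mat_mod[OF assms] by (simp add: zpow_def nat_mod_as_int [symmetric] flip: zmod_int)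

lemma zpow_add:
  assumes "A \<in> carrier_mat n n" "A ^\<^sub>m d = 1\<^sub>m n" "0 < d"
  shows "zpow d A (j + k) = zpow d A j * zpow d A k"
proof -
  define a b where "a = nat (j mod int d)" and "b = nat (k mod int d)"
  have "int a = j mod int d" "int b = k mod int d" using assms(3) by (auto simp: a_def b_def)
  then have "(j + k) mod int d = int (a + b) mod int d" by (simp add: mod_add_eq)
  then have "zpow d A (j + k) = zpow d A (int (a + b))" by (simp add: zpow_def)
  also have "\<dots> = A ^\<^sub>m a * A ^\<^sub>m b"
    using assms by (simp only: zpow_of_nat pow_mat_add)
  finally show ?thesis by (simp add: zpow_def a_def b_def)
qed

lemma zpow_0: "A \<in> carrier_mat n n \<Longrightarrow> zpow d A 0 = 1\<^sub>m n"
  by (auto simp: zpow_def)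

lemma smult_smult_times: "a \<cdot>\<^sub>m (b \<cdot>\<^sub>m A) = (a * b) \<cdot>\<^sub>m (A :: complex mat)"
  by (auto simp: mat_eq_iff)

lemma pow_mat_quasi_commute:
  assumes "A \<in> carrier_mat n n" "B \<in> carrier_mat n n" "A * B = c \<cdot>\<^sub>m (B * A)"
  shows "A ^\<^sub>m k * B = (c :: complex) ^ k \<cdot>\<^sub>m (B * A ^\<^sub>m k)"
proof (induction k)
  case 0
  then show ?case using assms by (auto simp: mat_eq_iff)
next
  case (Suc k)
  have "A ^\<^sub>m Suc k * B = A ^\<^sub>m k * (A * B)"
    using assms by (simp add: assoc_mult_mat[of _ n n _ n _ n])
  also have "\<dots> = c \<cdot>\<^sub>m (A ^\<^sub>m k * B * A)"
    using assms by (simp add: assoc_mult_mat[of _ n n _ n _ n] mult_smult_distrib[of _ n n _ n])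
  also have "\<dots> = c ^ Suc k \<cdot>\<^sub>m (B * A ^\<^sub>m Suc k)"
    using assms by (simp add: Suc assoc_mult_mat[of _ n n _ n _ n] mult_smult_assoc_mat[of _ n n _ n]
        smult_smult_times)
  finally show ?case .
qed

lemma zpow_quasi_commute:
  assumes "A \<in> carrier_mat n n" "B \<in> carrier_mat n n" "A * B = c \<cdot>\<^sub>m (B * A)" "(c::complex) ^ d = 1" "0 < d"
  shows "zpow d A k * B = c powi k \<cdot>\<^sub>m (B * zpow d A k)"
proof -
  have "c ^ nat (k mod int d) = c powi k"
    using root_unity_powi_mod[OF assms(4,5), of k] assms(5)
    by (metis int_nat_eq pos_mod_sign of_nat_0_less_iff power_int_of_nat)
  then show ?thesis using pow_mat_quasi_commute[OF assms(1-3)] by (simp add: zpow_def)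
qed

text \<open>The trace form is nondegenerate. This turns identities proved under
  \<open>tr (X * _)\<close> back into identities of matrices.\<close>

lemma mat_eq_by_trace:
  assumes A: "A \<in> carrier_mat n n" and B: "B \<in> carrier_mat n n"
    and eq: "\<And>X. X \<in> carrier_mat n n \<Longrightarrow> mat_trace (X * A) = mat_trace (X * B)"
  shows "A = B"
proof (rule eq_matI)
  fix i j assume "i < dim_row B" "j < dim_col B"
  then have ij: "i < n" "j < n" using B by auto
  \<comment> \<open>The matrix unit with its nonzero entry at \<open>(j, i)\<close>: the trace of
    its product with \<open>Y\<close> is the entry of \<open>Y\<close> at
    \<open>(i, j)\<close>.\<close>
  define X where "X = mat n n (\<lambda>(r, c). if r = j \<and> c = i then 1 else 0 :: complex)"
  have "mat_trace (X * Y) = Y $$ (i, j)" if "Y \<in> carrier_mat n n" for Y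
  proof -
    have "mat_trace (X * Y) = (\<Sum>r<n. if r = j then Y $$ (i, r) else 0)"
      unfolding mat_trace_def using that
    proof (intro sum.cong)
      fix r assume r: "r \<in> {..<n}"
      have "(X * Y) $$ (r, r) = (\<Sum>k = 0..<n. (if r = j \<and> k = i then 1 else 0) * Y $$ (k, r))"
        using r that by (auto simp: X_def scalar_prod_def intro!: sum.cong)
      also have "\<dots> = (\<Sum>k = 0..<n. (if k = i then (if r = j then Y $$ (i, r) else 0) else 0))"
        by (intro sum.cong) auto
      finally show "(X * Y) $$ (r, r) = (if r = j then Y $$ (i, r) else 0)"
        using ij by simp
    qed (auto simp: X_def)
    then show ?thesis using ij by simp
  qed
  from this[OF A] this[OF B] show "A $$ (i, j) = B $$ (i, j)"
    using eq[of X] by (simp add: X_def)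
qed (use A B in auto)

section \<open>Trace identities in a module\<close>

locale db_rep =
  fixes d :: nat and \<zeta> :: complex and M :: db_module
  assumes d_ge_2: "2 \<le> d" and primitive: "primitive_root_unity d \<zeta>" and M: "M \<in> db_modules d \<zeta>"
begin

abbreviation "n \<equiv> mdim M"
abbreviation "E \<equiv> actE M"
abbreviation "F \<equiv> actF M"
abbreviation "K \<equiv> actK M"
abbreviation "Z \<equiv> actZ M"

text \<open>The Cartan element \<open>K^b z^c\<close>, with exponents that matter only modulo
  \<open>d\<close>. In this single notation every product of powers of \<open>K\<close> and
  \<open>z\<close> collapses by adding exponents.\<close>

definition "H b c = zpow d K b * zpow d Z c"

lemma d_pos: "0 < d" using d_ge_2 by simp

lemma zeta_nz: "\<zeta> \<noteq> 0" using primitive_root_nonzero[OF primitive d_pos] .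

lemma zeta_neq_1: "\<zeta> \<noteq> 1"
  using primitive d_ge_2 by (auto simp: primitive_root_unity_def dest: spec[of _ 1])

lemma zeta_pow_d: "\<zeta> ^ d = 1" using primitive by (simp add: primitive_root_unity_def)

lemma zeta_add: "\<zeta> powi (j + k) = \<zeta> powi j * \<zeta> powi k"
  by (rule power_int_add) (use zeta_nz in simp)

lemma zeta_diff: "\<zeta> powi (j - k) = \<zeta> powi j / \<zeta> powi k"
  by (rule power_int_diff) (use zeta_nz in simp)

lemma qint_Suc_mult: "qint \<zeta> (Suc k) = 1 + \<zeta> * qint \<zeta> k"
  using zeta_neq_1 by (simp add: qint_eq field_simps)

lemma qint_Suc: "qint \<zeta> (Suc k) = qint \<zeta> k + \<zeta> ^ k"
  by (simp add: qint_def)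

text \<open>Comparison of coefficients in the induction steps of both commutator formulas below: in
  each of them one Cartan term carries \<open>\<zeta> powi (- int i)\<close> besides the
  q-integer.\<close>

lemma qint_shift: "qint \<zeta> (Suc (Suc i)) * \<zeta> powi (- int (Suc i))
    = qint \<zeta> (Suc i) * \<zeta> powi (- int i) + \<zeta> powi (- int (Suc i))"
proof -
  have "\<zeta> powi (- int i) = \<zeta> * \<zeta> powi (- int (Suc i))"
    using zeta_add[of 1 "- int (Suc i)"] by simp
  then show ?thesis by (simp only: qint_Suc_mult[of "Suc i"] distrib_right) simp
qed

lemma E_carrier [simp]: "E \<in> carrier_mat n n"
  and F_carrier [simp]: "F \<in> carrier_mat n n"
  and K_carrier [simp]: "K \<in> carrier_mat n n"
  and Z_carrier [simp]: "Z \<in> carrier_mat n n"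
  using M by (auto simp: db_modules_def Let_def)

lemma relations:
  "K ^\<^sub>m d = 1\<^sub>m n" "Z ^\<^sub>m d = 1\<^sub>m n" "Z * E = E * Z" "Z * F = F * Z" "Z * K = K * Z"
  "K * E = \<zeta> \<cdot>\<^sub>m (E * K)" "K * F = inverse \<zeta> \<cdot>\<^sub>m (F * K)" "E * F - F * E = K - Z * zpow d K (-1)"
  using M by (auto simp: db_modules_def Let_def)

lemma mult_carrier [simp]:
  "A \<in> carrier_mat n n \<Longrightarrow> B \<in> carrier_mat n n \<Longrightarrow> A * B \<in> carrier_mat n n"
  by simp

lemma mult_one [simp]:
  fixes A :: "complex mat"
  assumes "A \<in> carrier_mat n n"
  shows "A * 1\<^sub>m n = A" "1\<^sub>m n * A = A"
  using assms
  by auto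

lemma add_carrier [simp]:
  "A \<in> carrier_mat n n \<Longrightarrow> B \<in> carrier_mat n n \<Longrightarrow> A + B \<in> carrier_mat n n"
  "A \<in> carrier_mat n n \<Longrightarrow> B \<in> carrier_mat n n \<Longrightarrow> A - B \<in> carrier_mat n n"
  by auto

lemma dims [simp]: "dim_row E = n" "dim_col E = n" "dim_row F = n" "dim_col F = n"
  using E_carrier F_carrier by blast+

lemma H_carrier [simp]: "H b c \<in> carrier_mat n n"
  unfolding H_def by simp

lemma assoc [simp]:
  "A \<in> carrier_mat n n \<Longrightarrow> B \<in> carrier_mat n n \<Longrightarrow> C \<in> carrier_mat n n \<Longrightarrow> (A * B) * C = A * (B * C)"
  by (rule assoc_mult_mat)

lemma one_smult: "1 \<cdot>\<^sub>m (A :: complex mat) = A"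
  by (auto simp: mat_eq_iff)

lemma Z_commute:
  assumes "B \<in> carrier_mat n n" "Z * B = B * Z"
  shows "zpow d Z c * B = B * zpow d Z c"
  using zpow_quasi_commute[of Z n B 1 d c] assms d_pos by (simp add: one_smult)

lemma ZK_commute: "zpow d Z c * zpow d K b = zpow d K b * zpow d Z c"
proof -
  have "zpow d K b * Z = Z * zpow d K b"
    using zpow_quasi_commute[of K n Z 1 d b] relations(5) d_pos by (simp add: one_smult)
  then show ?thesis by (intro Z_commute) simp_all
qed

lemma H_add: "H b c * H b' c' = H (b + b') (c + c')"
proof -
  have "H b c * H b' c' = zpow d K b * ((zpow d Z c * zpow d K b') * zpow d Z c')"
    by (simp add: H_def)
  also have "\<dots> = (zpow d K b * zpow d K b') * (zpow d Z c * zpow d Z c')"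
    unfolding ZK_commute by simp
  finally show ?thesis using d_pos relations by (simp add: H_def zpow_add[of _ n])
qed

lemma H_0 [simp]: "H 0 0 = 1\<^sub>m n"
  by (simp add: H_def zpow_0[of _ n])

lemma zpow_1 [simp]: "A \<in> carrier_mat n n \<Longrightarrow> zpow d A 1 = A"
  using d_ge_2 by (simp add: zpow_def)

lemma H_mod: "H (b mod int d) c = H b c" "H b (c mod int d) = H b c"
  by (simp_all add: H_def)

lemma K_pow: "K ^\<^sub>m k = H (int k) 0"
  using zpow_of_nat[OF K_carrier relations(1), of k] by (simp add: H_def zpow_0[of _ n])

lemma Z_zpow: "zpow d Z c = H 0 c"
  by (simp add: H_def zpow_0[of _ n])

lemma K_zpow: "zpow d K c = H c 0"
  by (simp add: H_def zpow_0[of _ n])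

lemma K_H: "K = H 1 0" and Z_H: "Z = H 0 1"
  by (simp_all add: H_def zpow_0[of _ n])

lemma inverse_powi: "inverse \<zeta> powi b = \<zeta> powi (- b)"
  by (simp add: power_int_inverse power_int_minus)

lemma H_E: "H b c * E = \<zeta> powi b \<cdot>\<^sub>m (E * H b c)"
proof -
  have "H b c * E = (zpow d K b * E) * zpow d Z c"
    by (simp add: H_def Z_commute relations)
  also have "\<dots> = \<zeta> powi b \<cdot>\<^sub>m (E * H b c)"
    using d_pos by (simp add: zpow_quasi_commute[of K n E \<zeta> d b] relations(6) zeta_pow_d
        mult_smult_assoc_mat[of _ n n _ n] H_def)
  finally show ?thesis .
qed

lemma H_F: "H b c * F = \<zeta> powi (- b) \<cdot>\<^sub>m (F * H b c)"
proof -
  have "H b c * F = (zpow d K b * F) * zpow d Z c"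
    by (simp add: H_def Z_commute relations)
  also have "\<dots> = \<zeta> powi (- b) \<cdot>\<^sub>m (F * H b c)"
    using d_pos by (simp add: zpow_quasi_commute[of K n F "inverse \<zeta>" d b] relations(7) zeta_pow_d
        mult_smult_assoc_mat[of _ n n _ n] H_def power_inverse inverse_powi)
  finally show ?thesis .
qed

lemma E_F: "E * F = F * E + (H 1 0 - H (-1) 1)"
proof -
  have "E * F - F * E = H 1 0 - H (-1) 1"
    unfolding relations(8) using ZK_commute[of 1 "-1"] by (simp add: H_def zpow_0[of _ n])
  moreover have "E * F = F * E + (E * F - F * E)"
    by (rule eq_matI) (auto simp del: index_mult_mat(1) simp: index_mult_mat(2,3))
  ultimately show ?thesis by simp
qed

section \<open>Commutation rules under the trace\<close>

abbreviation "tr \<equiv> mat_trace"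

lemma tr_cyc: "A \<in> carrier_mat n n \<Longrightarrow> B \<in> carrier_mat n n \<Longrightarrow> tr (A * B) = tr (B * A)"
  by (rule mat_trace_comm)

lemmas distribs = add_mult_distrib_mat[of _ n n _ _ n] mult_add_distrib_mat[of _ n n _ n]
  minus_mult_distrib_mat[of _ n n _ _ n] mult_minus_distrib_mat[of _ n n _ n]
  mult_smult_assoc_mat[of _ n n _ n] mult_smult_distrib[of _ n n _ n]
  mat_trace_add[of _ n] mat_trace_minus[of _ n] mat_trace_smult[of _ n]

text \<open>\<open>X\<close> and \<open>Y\<close> are the arbitrary rest of a word. In this form a
  relation applies at any position of a right-associated product, and its scalars multiply complex
  numbers rather than matrices.\<close>

lemma tr_EF:
  assumes [simp]: "X \<in> carrier_mat n n" "Y \<in> carrier_mat n n"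
  shows "tr (X * (E * (F * Y))) = tr (X * (F * (E * Y))) + tr (X * (H 1 0 * Y)) - tr (X * (H (-1) 1 * Y))"
proof -
  have "tr (X * (E * (F * Y))) = tr (X * ((E * F) * Y))" by simp
  also have "\<dots> = tr (X * (F * (E * Y))) + tr (X * (H 1 0 * Y)) - tr (X * (H (-1) 1 * Y))"
    unfolding E_F by (simp add: distribs)
  finally show ?thesis .
qed

lemma tr_HE:
  assumes [simp]: "X \<in> carrier_mat n n" "Y \<in> carrier_mat n n"
  shows "tr (X * (H b c * (E * Y))) = \<zeta> powi b * tr (X * (E * (H b c * Y)))"
proof -
  have "tr (X * (H b c * (E * Y))) = tr (X * ((H b c * E) * Y))" by simp
  then show ?thesis unfolding H_E by (simp add: distribs)
qed

lemma tr_HF: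
  assumes [simp]: "X \<in> carrier_mat n n" "Y \<in> carrier_mat n n"
  shows "tr (X * (H b c * (F * Y))) = \<zeta> powi (- b) * tr (X * (F * (H b c * Y)))"
proof -
  have "tr (X * (H b c * (F * Y))) = tr (X * ((H b c * F) * Y))" by simp
  then show ?thesis unfolding H_F by (simp add: distribs)
qed

lemma H_E_pow: "H b c * E ^\<^sub>m i = \<zeta> powi (b * int i) \<cdot>\<^sub>m (E ^\<^sub>m i * H b c)"
proof (induction i)
  case (Suc i)
  have "H b c * E ^\<^sub>m Suc i = (H b c * E ^\<^sub>m i) * E" by simp
  also have "\<dots> = \<zeta> powi (b * int (Suc i)) \<cdot>\<^sub>m (E ^\<^sub>m Suc i * H b c)"
    unfolding Suc by (simp add: distribs H_E smult_smult_times zeta_add algebra_simps)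
  finally show ?case .
qed (simp add: one_smult)

lemma H_F_pow: "H b c * F ^\<^sub>m i = \<zeta> powi (- (b * int i)) \<cdot>\<^sub>m (F ^\<^sub>m i * H b c)"
proof (induction i)
  case (Suc i)
  have "H b c * F ^\<^sub>m Suc i = (H b c * F ^\<^sub>m i) * F" by simp
  also have "\<dots> = \<zeta> powi (- (b * int (Suc i))) \<cdot>\<^sub>m (F ^\<^sub>m Suc i * H b c)"
    unfolding Suc by (simp add: distribs H_F smult_smult_times zeta_add [symmetric] algebra_simps)
  finally show ?case .
qed (simp add: one_smult)

lemma tr_HE_pow:
  assumes [simp]: "X \<in> carrier_mat n n" "Y \<in> carrier_mat n n"
  shows "tr (X * (H b c * (E ^\<^sub>m i * Y))) = \<zeta> powi (b * int i) * tr (X * (E ^\<^sub>m i * (H b c * Y)))"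
proof -
  have "tr (X * (H b c * (E ^\<^sub>m i * Y))) = tr (X * ((H b c * E ^\<^sub>m i) * Y))" by simp
  then show ?thesis unfolding H_E_pow by (simp add: distribs)
qed

lemma tr_HF_pow:
  assumes [simp]: "X \<in> carrier_mat n n" "Y \<in> carrier_mat n n"
  shows "tr (X * (H b c * (F ^\<^sub>m i * Y))) = \<zeta> powi (- (b * int i)) * tr (X * (F ^\<^sub>m i * (H b c * Y)))"
proof -
  have "tr (X * (H b c * (F ^\<^sub>m i * Y))) = tr (X * ((H b c * F ^\<^sub>m i) * Y))" by simp
  then show ?thesis unfolding H_F_pow by (simp add: distribs)
qed

text \<open>This is \<open>[E, F^(i+1)] = (i+1)_\<zeta> F^i (\<zeta>^(-i) K - z K^(-1))\<close>
  inside an arbitrary word. The induction splits one \<open>F\<close> off the power and moves it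
  into \<open>X\<close>, so \<open>X\<close> has to vary.\<close>

lemma tr_E_F_pow:
  assumes "X \<in> carrier_mat n n" and [simp]: "Y \<in> carrier_mat n n"
  shows "tr (X * (E * (F ^\<^sub>m Suc i * Y))) = tr (X * (F ^\<^sub>m Suc i * (E * Y)))
    + qint \<zeta> (Suc i) * (\<zeta> powi (- int i) * tr (X * (F ^\<^sub>m i * (H 1 0 * Y))) - tr (X * (F ^\<^sub>m i * (H (-1) 1 * Y))))"
  using assms(1)
proof (induction i arbitrary: X)
  case 0
  then show ?case by (simp add: tr_EF qint_def)
next
  case (Suc i)
  note [simp] = Suc.prems
  have "tr (X * (E * (F ^\<^sub>m Suc (Suc i) * Y))) = tr (X * (E * (F * (F ^\<^sub>m Suc i * Y))))"
    by (subst pow_mat_Suc_left[of _ n]) (simp_all del: pow_mat.simps)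
  also have "\<dots> = tr (X * F * (E * (F ^\<^sub>m Suc i * Y)))
      + \<zeta> powi (- int (Suc i)) * tr (X * (F ^\<^sub>m Suc i * (H 1 0 * Y)))
      - \<zeta> powi (int (Suc i)) * tr (X * (F ^\<^sub>m Suc i * (H (-1) 1 * Y)))"
    by (subst tr_EF) (simp_all del: pow_mat.simps of_nat_Suc add: tr_HF_pow)
  also have "tr (X * F * (E * (F ^\<^sub>m Suc i * Y))) = tr (X * (F ^\<^sub>m Suc (Suc i) * (E * Y)))
    + qint \<zeta> (Suc i) * (\<zeta> powi (- int i) * tr (X * (F ^\<^sub>m Suc i * (H 1 0 * Y))) - tr (X * (F ^\<^sub>m Suc i * (H (-1) 1 * Y))))"
    by (subst Suc.IH) (simp_all del: pow_mat.simps add: pow_mat_Suc_left[of F n])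
  moreover have "qint \<zeta> (Suc (Suc i)) * \<zeta> powi (- int (Suc i))
      = qint \<zeta> (Suc i) * \<zeta> powi (- int i) + \<zeta> powi (- int (Suc i))"
    using qint_shift .
  moreover have "qint \<zeta> (Suc (Suc i)) = qint \<zeta> (Suc i) + \<zeta> powi (int (Suc i))"
    using qint_Suc[of "Suc i"] by (simp only: power_int_of_nat)
  ultimately show ?case
    by (simp only: right_diff_distrib distrib_right mult.assoc [symmetric]) (simp only: algebra_simps)
qed

text \<open>The mirror formula
  \<open>[E^(i+1), F] = (i+1)_\<zeta> E^i (K - \<zeta>^(-i) z K^(-1))\<close>; here an
  \<open>E\<close> moves into \<open>X\<close>.\<close>

lemma tr_E_pow_F:
  assumes "X \<in> carrier_mat n n" and [simp]: "Y \<in> carrier_mat n n"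
  shows "tr (X * (E ^\<^sub>m Suc i * (F * Y))) = tr (X * (F * (E ^\<^sub>m Suc i * Y)))
    + qint \<zeta> (Suc i) * (tr (X * (E ^\<^sub>m i * (H 1 0 * Y))) - \<zeta> powi (- int i) * tr (X * (E ^\<^sub>m i * (H (-1) 1 * Y))))"
  using assms(1)
proof (induction i arbitrary: X)
  case 0
  then show ?case by (simp add: tr_EF qint_def)
next
  case (Suc i)
  note [simp] = Suc.prems
  have "tr (X * (E ^\<^sub>m Suc (Suc i) * (F * Y))) = tr (X * E * (E ^\<^sub>m Suc i * (F * Y)))"
    by (subst pow_mat_Suc_left[of _ n]) (simp_all del: pow_mat.simps)
  also have "\<dots> = tr (X * (E * (F * (E ^\<^sub>m Suc i * Y))))
    + qint \<zeta> (Suc i) * (tr (X * (E ^\<^sub>m Suc i * (H 1 0 * Y))) - \<zeta> powi (- int i) * tr (X * (E ^\<^sub>m Suc i * (H (-1) 1 * Y))))"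
    by (subst Suc.IH) (simp_all del: pow_mat.simps add: pow_mat_Suc_left[of E n])
  also have "tr (X * (E * (F * (E ^\<^sub>m Suc i * Y)))) = tr (X * (F * (E ^\<^sub>m Suc (Suc i) * Y)))
      + \<zeta> powi (int (Suc i)) * tr (X * (E ^\<^sub>m Suc i * (H 1 0 * Y)))
      - \<zeta> powi (- int (Suc i)) * tr (X * (E ^\<^sub>m Suc i * (H (-1) 1 * Y)))"
    by (subst tr_EF) (simp_all del: pow_mat.simps of_nat_Suc add: tr_HE_pow pow_mat_Suc_left[of E n "Suc i"])
  moreover have "qint \<zeta> (Suc (Suc i)) * \<zeta> powi (- int (Suc i))
      = qint \<zeta> (Suc i) * \<zeta> powi (- int i) + \<zeta> powi (- int (Suc i))"
    using qint_shift .
  moreover have "qint \<zeta> (Suc (Suc i)) = qint \<zeta> (Suc i) + \<zeta> powi (int (Suc i))"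
    using qint_Suc[of "Suc i"] by (simp only: power_int_of_nat)
  ultimately show ?case
    by (simp only: right_diff_distrib distrib_right mult.assoc [symmetric]) (simp only: algebra_simps)
qed

section \<open>Recursions for traces with equal powers of \<open>E\<close> and
  \<open>F\<close>\<close>

definition "\<tau> i b c = tr (E ^\<^sub>m i * (F ^\<^sub>m i * H b c))"
definition "\<sigma> i b c = tr (F ^\<^sub>m i * (E ^\<^sub>m i * H b c))"

text \<open>One trace is computed in two ways. Taking a leading \<open>E\<close> cyclically round
  past \<open>H b c\<close> costs \<open>\<zeta> powi b\<close>, taking it through
  \<open>F ^\<^sub>m Suc i\<close> costs the commutator. Eliminating the common trace gives the
  recursion; \<open>1 - \<zeta> powi b\<close> stays on the left because it may vanish.\<close>

lemma \<tau>_Suc: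
  "(1 - \<zeta> powi b) * \<tau> (Suc i) b c
    = - (\<zeta> powi b) * qint \<zeta> (Suc i) * (\<zeta> powi (- int i) * \<tau> i (b + 1) c - \<tau> i (b - 1) (c + 1))"
proof -
  have "\<tau> (Suc i) b c = tr (E * (E ^\<^sub>m i * (F ^\<^sub>m Suc i * H b c)))"
    by (simp add: \<tau>_def pow_mat_Suc_left[of E n] del: pow_mat.simps)
  also have "\<dots> = tr ((E ^\<^sub>m i * F ^\<^sub>m Suc i) * (H b c * (E * 1\<^sub>m n)))"
    by (subst tr_cyc) (simp_all del: pow_mat.simps)
  also have "\<dots> = \<zeta> powi b * tr (E ^\<^sub>m i * (F ^\<^sub>m Suc i * (E * H b c)))"
    by (subst tr_HE) (simp_all del: pow_mat.simps)
  finally have 1: "\<tau> (Suc i) b c = \<zeta> powi b * tr (E ^\<^sub>m i * (F ^\<^sub>m Suc i * (E * H b c)))" .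
  have "\<tau> (Suc i) b c = tr (E ^\<^sub>m i * (E * (F ^\<^sub>m Suc i * H b c)))"
    by (simp add: \<tau>_def)
  also have "\<dots> = tr (E ^\<^sub>m i * (F ^\<^sub>m Suc i * (E * H b c)))
    + qint \<zeta> (Suc i) * (\<zeta> powi (- int i) * \<tau> i (b + 1) c - \<tau> i (b - 1) (c + 1))"
    by (subst tr_E_F_pow) (simp_all del: pow_mat.simps add: H_add \<tau>_def add.commute)
  finally have 2: "\<tau> (Suc i) b c = tr (E ^\<^sub>m i * (F ^\<^sub>m Suc i * (E * H b c)))
    + qint \<zeta> (Suc i) * (\<zeta> powi (- int i) * \<tau> i (b + 1) c - \<tau> i (b - 1) (c + 1))" .
  have "(1 - z) * t = - z * q * r" if "t = z * w" "t = w + q * r" for z t w q r :: complex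
    using that by Groebner_Basis.algebra
  from this[OF 1 2] show ?thesis .
qed

text \<open>The same comparison with a leading \<open>F\<close>, which passes \<open>H b c\<close>
  at the cost of \<open>\<zeta> powi (- b)\<close> and is then carried back through the power of
  \<open>E\<close>.\<close>

lemma \<sigma>_Suc:
  "(1 - \<zeta> powi (- b)) * \<sigma> (Suc i) b c
    = \<zeta> powi (- b) * qint \<zeta> (Suc i) * (\<sigma> i (b + 1) c - \<zeta> powi (- int i) * \<sigma> i (b - 1) (c + 1))"
proof -
  have "\<sigma> (Suc i) b c = tr (F * (F ^\<^sub>m i * (E ^\<^sub>m Suc i * H b c)))"
    by (simp add: \<sigma>_def pow_mat_Suc_left[of F n] del: pow_mat.simps)
  also have "\<dots> = tr ((F ^\<^sub>m i * E ^\<^sub>m Suc i) * (H b c * (F * 1\<^sub>m n)))"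
    by (subst tr_cyc) (simp_all del: pow_mat.simps)
  also have "\<dots> = \<zeta> powi (- b) * tr (F ^\<^sub>m i * (E ^\<^sub>m Suc i * (F * H b c)))"
    by (subst tr_HF) (simp_all del: pow_mat.simps)
  also have "tr (F ^\<^sub>m i * (E ^\<^sub>m Suc i * (F * H b c))) = \<sigma> (Suc i) b c
    + qint \<zeta> (Suc i) * (\<sigma> i (b + 1) c - \<zeta> powi (- int i) * \<sigma> i (b - 1) (c + 1))"
    by (subst tr_E_pow_F) (simp_all add: H_add \<sigma>_def add.commute)
  finally have 1: "\<sigma> (Suc i) b c = \<zeta> powi (- b) * (\<sigma> (Suc i) b c
    + qint \<zeta> (Suc i) * (\<sigma> i (b + 1) c - \<zeta> powi (- int i) * \<sigma> i (b - 1) (c + 1)))" .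
  have "(1 - z) * t = z * q * r" if "t = z * (t + q * r)" for z t q r :: complex
    using that by Groebner_Basis.algebra
  from this[OF 1] show ?thesis .
qed

text \<open>The traces on \<open>M\<close> in the entries of the two partial quantum traces; \<open>s\<close> and \<open>a\<close> are the exponents
  of \<open>\<zeta>\<close> in the eigenvalues of \<open>z\<close> and \<open>K\<close> at a vector of \<open>M\<^sub>\<lambda>\<close>.\<close>

definition "T s i a = tr (E ^\<^sub>m i * (H (a - s) 0 * (F ^\<^sub>m i * H (a + int i + 1) (- (a + int i + 1)))))"
definition "U s i a = tr (F ^\<^sub>m i * (H a (- a) * (E ^\<^sub>m i * H (a - s - int i - 1) 1)))"

lemma T_eq: "T s i a = \<zeta> powi (- ((a - s) * int i)) * \<tau> i (2 * a - s + int i + 1) (- (a + int i + 1))"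
proof -
  show ?thesis by (simp add: T_def tr_HF_pow H_add \<tau>_def) (simp add: algebra_simps)
qed

lemma U_eq: "U s i a = \<zeta> powi (a * int i) * \<sigma> i (2 * a - s - int i - 1) (1 - a)"
proof -
  show ?thesis by (simp add: U_def tr_HE_pow H_add \<sigma>_def) (simp add: algebra_simps)
qed

text \<open>Up to powers of \<zeta>, \<open>T s i a\<close> and \<open>T s i (a - 1)\<close> are the
  two traces on the right of \<open>\<tau>_Suc\<close>, and \<open>T s (Suc i) (a - 1)\<close> is
  the one on its left. The remaining difference of powers reappears, up to
  \<open>\<zeta> powi (- (1 + s))\<close>, on the simple module in
  \<open>\<phi>_diff\<close>.\<close>

lemma T_diff:
  "qint \<zeta> (Suc i) * (T s i a - T s i (a - 1))
    = (\<zeta> powi (a - s - 1) - \<zeta> powi (- a - int i - 1)) * T s (Suc i) (a - 1)"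
proof -
  \<comment> \<open>Once collected at the end of the word, the exponents of \<open>K\<close> in
    \<open>T s i a\<close> and \<open>T s i (a - 1)\<close> are \<open>b + 1\<close> and
    \<open>b - 1\<close>.\<close>
  define b where "b = 2 * a - s + int i"
  define c where "c = - (a + int i + 1)"
  define t where "t = \<zeta> powi (- ((a - s) * int i))"
  have T1: "T s i a = t * \<tau> i (b + 1) c"
    by (simp add: T_eq t_def b_def c_def algebra_simps)
  have T2: "T s i (a - 1) = t * \<zeta> powi int i * \<tau> i (b - 1) (c + 1)"
    by (simp add: T_eq t_def b_def c_def zeta_add [symmetric] algebra_simps del: power_int_of_nat)
  have T3: "T s (Suc i) (a - 1) = t * \<zeta> powi (int i - (a - s) + 1) * \<tau> (Suc i) b c"
    by (simp add: T_eq t_def b_def c_def zeta_add [symmetric] algebra_simps del: power_int_of_nat)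
  have "(\<zeta> powi (a - s - 1) - \<zeta> powi (- a - int i - 1)) * T s (Suc i) (a - 1)
     = t * (\<zeta> powi int i * \<zeta> powi (- b)) * - ((1 - \<zeta> powi b) * \<tau> (Suc i) b c)"
  proof -
    have alg: "(x - y) * (t * u * w) = t * (v * z') * - ((1 - z) * w)"
      if "x * u = v" "y * u = v * z'" "z' * z = 1" for x y u v w z z' :: complex
    proof -
      have "(x - y) * (t * u * w) = t * w * (x * u - y * u)" by (simp add: algebra_simps)
      also have "\<dots> = t * w * (v * (z' * z) - v * z')" using that by simp
      finally show ?thesis by (simp add: algebra_simps)
    qed
    have "\<zeta> powi (a - s - 1) * \<zeta> powi (int i - (a - s) + 1) = \<zeta> powi int i"
      by (simp add: zeta_add [symmetric] del: power_int_of_nat)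
    moreover have "\<zeta> powi (- a - int i - 1) * \<zeta> powi (int i - (a - s) + 1) = \<zeta> powi int i * \<zeta> powi (- b)"
      by (simp add: b_def zeta_add [symmetric] algebra_simps del: power_int_of_nat)
    moreover have "\<zeta> powi (- b) * \<zeta> powi b = 1"
      by (simp add: zeta_add [symmetric])
    ultimately show ?thesis unfolding T3 by (rule alg)
  qed
  also have "\<dots> = qint \<zeta> (Suc i) * (T s i a - T s i (a - 1))"
    unfolding \<tau>_Suc T1 T2 using zeta_nz by (simp add: power_int_minus field_simps)
  finally show ?thesis by simp
qed

text \<open>In \<open>U\<close> the collected exponent of \<open>K\<close> decreases with
  \<open>i\<close>, whereas it increases in \<open>T\<close>. Hence the trace of next order that
  fits between \<open>a\<close> and \<open>a - 1\<close> is the one at \<open>a\<close>.\<close>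

lemma U_diff:
  "qint \<zeta> (Suc i) * (U s i a - U s i (a - 1))
    = (\<zeta> powi (a - s - int i - 2) - \<zeta> powi (- a)) * U s (Suc i) a"
proof -
  define b where "b = 2 * a - s - int i - 2"
  define c where "c = 1 - a"
  define t where "t = \<zeta> powi (a * int i)"
  have U1: "U s i a = t * \<sigma> i (b + 1) c"
    by (simp add: U_eq t_def b_def c_def algebra_simps)
  have U2: "U s i (a - 1) = t * \<zeta> powi (- int i) * \<sigma> i (b - 1) (c + 1)"
    by (simp add: U_eq t_def b_def c_def zeta_add [symmetric] algebra_simps del: power_int_of_nat)
  have U3: "U s (Suc i) a = t * \<zeta> powi a * \<sigma> (Suc i) b c"
    by (simp add: U_eq t_def b_def c_def zeta_add [symmetric] algebra_simps del: power_int_of_nat)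
  have "(\<zeta> powi (a - s - int i - 2) - \<zeta> powi (- a)) * U s (Suc i) a
     = t * \<zeta> powi b * ((1 - \<zeta> powi (- b)) * \<sigma> (Suc i) b c)"
  proof -
    have alg: "(x - y) * (t * u * w) = t * z * ((1 - z') * w)"
      if "x * u = z" "y * u = 1" "z' * z = 1" for x y u w z z' :: complex
    proof -
      have "(x - y) * (t * u * w) = t * w * (x * u - y * u)" by (simp add: algebra_simps)
      also have "\<dots> = t * w * (z - z' * z)" using that by simp
      finally show ?thesis by (simp add: algebra_simps)
    qed
    have "\<zeta> powi (a - s - int i - 2) * \<zeta> powi a = \<zeta> powi b"
      by (simp add: b_def zeta_add [symmetric] algebra_simps)
    moreover have "\<zeta> powi (- a) * \<zeta> powi a = 1" "\<zeta> powi (- b) * \<zeta> powi b = 1"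
      by (simp_all add: zeta_add [symmetric])
    ultimately show ?thesis unfolding U3 by (rule alg)
  qed
  also have "\<dots> = qint \<zeta> (Suc i) * (U s i a - U s i (a - 1))"
    unfolding \<sigma>_Suc U1 U2 using zeta_nz by (simp add: power_int_minus field_simps)
  finally show ?thesis by simp
qed

section \<open>The Casimir element and the reflection of traces\<close>

definition "central A \<longleftrightarrow> A \<in> carrier_mat n n \<and> A * E = E * A \<and> A * F = F * A \<and> (\<forall>b c. A * H b c = H b c * A)"

text \<open>The quantum Casimir element; on \<open>M\<^sub>l\<^sub>,\<^sub>p\<close> it is the
  scalar \<open>\<zeta>^(p+l) + \<zeta>^p\<close>, as its value at the highest weight vector shows.
  Its two Cartan terms couple the exponents \<open>a + 1\<close> and \<open>a - 1\<close> of
  \<open>K\<close> in the recursion below.\<close>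

definition "casimir = (\<zeta> - 1) \<cdot>\<^sub>m (F * E) + (\<zeta> \<cdot>\<^sub>m H 1 0 + H (-1) 1)"

lemma smult_carrier [simp]: "A \<in> carrier_mat n n \<Longrightarrow> x \<cdot>\<^sub>m A \<in> carrier_mat n n"
  by simp

lemma tr_casimir:
  assumes [simp]: "X \<in> carrier_mat n n" "Y \<in> carrier_mat n n"
  shows "tr (X * (casimir * Y)) = (\<zeta> - 1) * tr (X * (F * (E * Y))) + \<zeta> * tr (X * (H 1 0 * Y)) + tr (X * (H (-1) 1 * Y))"
  by (simp add: casimir_def distribs)

lemma casimir_carrier [simp]: "casimir \<in> carrier_mat n n"
  by (simp add: casimir_def)

text \<open>Commuting \<open>F E\<close> with \<open>E\<close> or \<open>F\<close> leaves Cartan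
  terms times that generator; the coefficients \<zeta> and 1 of the Cartan part of
  \<open>casimir\<close> are the ones that cancel them.\<close>

lemma central_casimir: "central casimir"
  unfolding central_def
proof (intro conjI allI)
  show "casimir * E = E * casimir"
  proof (rule mat_eq_by_trace)
    fix X :: "complex mat" assume [simp]: "X \<in> carrier_mat n n"
    show "tr (X * (casimir * E)) = tr (X * (E * casimir))"
      using tr_casimir[of "X * E" "1\<^sub>m n"] tr_HE[of X "1\<^sub>m n" 1 0] tr_HE[of X "1\<^sub>m n" "-1" 1] zeta_nz
      by (simp add: tr_casimir tr_EF tr_HE power_int_minus field_simps)
  qed simp_all
  show "casimir * F = F * casimir"
  proof (rule mat_eq_by_trace)
    fix X :: "complex mat" assume [simp]: "X \<in> carrier_mat n n"
    show "tr (X * (casimir * F)) = tr (X * (F * casimir))"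
      using tr_casimir[of "X * F" "1\<^sub>m n"] tr_EF[of "X * F" "1\<^sub>m n"]
        tr_HF[of X "1\<^sub>m n" 1 0] tr_HF[of X "1\<^sub>m n" "-1" 1] zeta_nz
      by (simp add: tr_casimir power_int_minus field_simps) Groebner_Basis.algebra
  qed simp_all
  show "casimir * H b c = H b c * casimir" for b c
  proof (rule mat_eq_by_trace)
    fix X :: "complex mat" assume [simp]: "X \<in> carrier_mat n n"
    show "tr (X * (casimir * H b c)) = tr (X * (H b c * casimir))"
      using tr_casimir[of "X * H b c" "1\<^sub>m n"] tr_HF[of X "E" b c] tr_HE[of "X * F" "1\<^sub>m n" b c] zeta_nz
      by (simp add: tr_casimir H_add power_int_minus add.commute)
  qed simp_all
qed simp

text \<open>Matrices satisfying \<open>central\<close> are the endomorphisms of the module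
  \<open>M\<close>. Closure under products allows \<open>A * casimir\<close> to take the place of
  \<open>A\<close> in the induction below.\<close>

lemma central_mult:
  assumes "central A" "central B"
  shows "central (A * B)"
proof -
  have [simp]: "A \<in> carrier_mat n n" "B \<in> carrier_mat n n" using assms by (auto simp: central_def)
  have "A * B * C = C * (A * B)" if [simp]: "C \<in> carrier_mat n n" and c: "A * C = C * A" "B * C = C * B" for C
  proof -
    have "A * B * C = (A * C) * B" using c(2) by simp
    then show ?thesis using c(1) by simp
  qed
  then show ?thesis using assms unfolding central_def by auto
qed

text \<open>Since \<open>A\<close> commutes with \<open>F\<close>, the \<open>F\<close> of
  \<open>casimir\<close> can be taken cyclically round the trace. This expresses
  \<open>1 - \<zeta> powi (- a)\<close> times the trace of \<open>A F E K^a z^c\<close> through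
  Cartan traces and leaves a relation between neighbouring exponents of \<open>K\<close>.\<close>

lemma central_casimir_rec:
  assumes "central A"
  shows "(1 - \<zeta> powi (- a)) * tr (A * casimir * H a c)
    = (\<zeta> - \<zeta> powi (- a)) * tr (A * H (a + 1) c) + (1 - \<zeta> powi (1 - a)) * tr (A * H (a - 1) (c + 1))"
proof -
  have [simp]: "A \<in> carrier_mat n n" and comm: "A * F = F * A" using assms by (auto simp: central_def)
  have "tr (A * (F * (E * H a c))) = tr (F * (A * (E * H a c)))"
    using comm by (metis E_carrier F_carrier H_carrier \<open>A \<in> carrier_mat n n\<close> assoc mult_carrier)
  also have "\<dots> = tr (A * E * (H a c * (F * 1\<^sub>m n)))"
    by (subst tr_cyc) simp_all
  also have "\<dots> = \<zeta> powi (- a) * tr (A * (E * (F * H a c)))"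
    by (subst tr_HF) simp_all
  also have "tr (A * (E * (F * H a c))) = tr (A * (F * (E * H a c))) + tr (A * H (a + 1) c) - tr (A * H (a - 1) (c + 1))"
    by (subst tr_EF) (simp_all add: H_add add.commute)
  finally have 1: "tr (A * (F * (E * H a c))) = \<zeta> powi (- a) *
    (tr (A * (F * (E * H a c))) + tr (A * H (a + 1) c) - tr (A * H (a - 1) (c + 1)))" .
  have 2: "tr (A * casimir * H a c) = (\<zeta> - 1) * tr (A * (F * (E * H a c))) + \<zeta> * tr (A * H (a + 1) c)
      + tr (A * H (a - 1) (c + 1))"
    by (simp add: tr_casimir H_add add.commute)
  have 3: "\<zeta> powi (1 - a) = \<zeta> * \<zeta> powi (- a)"
    using zeta_add[of 1 "- a"] by simp
  have "(1 - z) * ((\<zeta> - 1) * t + \<zeta> * x + y) = (\<zeta> - z) * x + (1 - \<zeta> * z) * y"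
    if "t = z * (t + x - y)" for t x y z
    using that by Groebner_Basis.algebra
  from this[OF 1] show ?thesis unfolding 2 3 .
qed

text \<open>On an irreducible module the eigenvalues of \<open>K\<close> are exchanged by \<open>K \<mapsto> zK\<^sup>-\<^sup>1\<close>; the induction
  over central elements avoids composition series.\<close>

lemma central_trace_reflect:
  assumes "central A" "a < d"
  shows "tr (A * H (int a) c) = tr (A * H (- int a) (c + int a))
    \<and> tr (A * H (int a + 1) c) = tr (A * H (- int a - 1) (c + int a + 1))"
  using assms
\<comment> \<open>Two neighbouring exponents are carried along because the recursion has three
  terms; \<open>A\<close> and \<open>c\<close> vary because the step uses the claim for
  \<open>A * casimir\<close> and for \<open>c + 1\<close>.\<close>
proof (induction a arbitrary: A c)
  case 0
  \<comment> \<open>At exponent 0 the Casimir term of the recursion has coefficient 0, and the other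
    two terms are the claim for exponent 1.\<close>
  then have "(1 - \<zeta>) * tr (A * H 1 c) = (1 - \<zeta>) * tr (A * H (-1) (c + 1))"
    using central_casimir_rec[of A 0 c] by (simp add: algebra_simps)
  then show ?case using zeta_neq_1 by simp
next
  case (Suc a)
  let ?a = "int a + 1"
  have "central (A * casimir)" using Suc.prems central_casimir central_mult by blast
  then have IH: "tr (A * casimir * H ?a c) = tr (A * casimir * H (- ?a) (c + ?a))"
    using Suc.IH[of "A * casimir" c] Suc.prems by (simp add: add.assoc)
  have IH': "tr (A * H (?a - 1) (c + 1)) = tr (A * H (1 - ?a) (c + ?a))"
    using Suc.IH[of A "c + 1"] Suc.prems by (simp add: algebra_simps)
  have r1: "(1 - \<zeta> powi (- ?a)) * tr (A * casimir * H ?a c)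
    = (\<zeta> - \<zeta> powi (- ?a)) * tr (A * H (?a + 1) c) + (1 - \<zeta> powi (1 - ?a)) * tr (A * H (?a - 1) (c + 1))"
    using central_casimir_rec[OF Suc.prems(1)] .
  have r2: "(1 - \<zeta> powi ?a) * tr (A * casimir * H (- ?a) (c + ?a))
    = (\<zeta> - \<zeta> powi ?a) * tr (A * H (1 - ?a) (c + ?a)) + (1 - \<zeta> powi (1 + ?a)) * tr (A * H (- ?a - 1) (c + ?a + 1))"
    using central_casimir_rec[OF Suc.prems(1), of "- ?a" "c + ?a"] by (simp add: algebra_simps)
  define z where "z = \<zeta> powi (- ?a)"
  have z1: "\<zeta> powi ?a * z = 1" unfolding z_def by (simp add: zeta_add [symmetric])
  have z2: "\<zeta> powi (1 + ?a) * z = \<zeta>" "\<zeta> powi (1 - ?a) = \<zeta> * z"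
    unfolding z_def zeta_add [symmetric] using zeta_add[of 1 "- ?a"] by simp_all
  \<comment> \<open>Multiplied by \<open>- z\<close>, the relation \<open>r2\<close> acquires the
    coefficients of \<open>r1\<close>; by \<open>IH\<close> and \<open>IH'\<close> everything but
    the new pair of traces cancels.\<close>
  have eq: "(\<zeta> - z) * tr (A * H (?a + 1) c) = (\<zeta> - z) * tr (A * H (- ?a - 1) (c + ?a + 1))"
    using r1 r2 z1 z2 IH IH' unfolding z_def [symmetric] by Groebner_Basis.algebra
  have "tr (A * H (?a + 1) c) = tr (A * H (- ?a - 1) (c + ?a + 1))"
  proof (cases "?a + 1 = int d")
    case False
    then have "\<not> int d dvd ?a + 1"
      using Suc.prems zdvd_imp_le[of "int d" "?a + 1"] by auto
    then have "\<zeta> powi (?a + 1) \<noteq> 1"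
      using primitive_root_powi_eq_1_iff[OF primitive d_pos] by blast
    moreover have "\<zeta> powi (?a + 1) = 1" if "\<zeta> = z"
      using z1 that zeta_add[of ?a 1] by simp
    ultimately have "\<zeta> - z \<noteq> 0" by auto
    then show ?thesis using eq by simp
  next
    \<comment> \<open>Here \<open>\<zeta> - z\<close> vanishes and \<open>eq\<close> is void, but
      both exponents of \<open>K\<close> are multiples of \<open>d\<close>, so periodicity gives the
      equality.\<close>
    case True
    have "H (?a + 1) c = H 0 c" using H_mod(1)[of "?a + 1" c] True by simp
    moreover have "H (- ?a - 1) (c + ?a + 1) = H ((- int d) mod int d) ((c + int d) mod int d)"
    proof -
      have "- ?a - 1 = - int d" "c + ?a + 1 = c + int d" using True by auto
      then show ?thesis by (simp only: H_mod)
    qed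
    ultimately show ?thesis by (simp add: H_mod)
  qed
  moreover have "tr (A * H ?a c) = tr (A * H (- ?a) (c + ?a))"
    using Suc.IH[of A c] Suc.prems by (simp add: add.assoc)
  moreover have "int (Suc a) = ?a" by simp
  ultimately show ?case by (simp only:)
qed

text \<open>The case of the identity endomorphism. The second half of the previous claim, used at
  \<open>a - 1\<close>, also reaches \<open>a = d\<close>, which is wanted for
  \<open>l = d\<close>.\<close>

lemma trace_reflect:
  assumes "0 \<le> a" "a \<le> int d"
  shows "tr (H a c) = tr (H (- a) (c + a))"
proof -
  have *: "central (1\<^sub>m n)" by (auto simp: central_def)
  show ?thesis
  proof (cases "a = 0")
    case False
    then obtain k where k: "a = int k + 1" "k < d"
      using assms by (intro that[of "nat (a - 1)"]) auto
    then show ?thesis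
      using central_trace_reflect[OF * k(2), of c] by (simp only: k(1) mult_one H_carrier) (simp add: add.assoc)
  qed simp
qed

end

section \<open>Kronecker products and the double braiding\<close>

lemma kron_carrier [simp]:
  "A \<in> carrier_mat m m' \<Longrightarrow> B \<in> carrier_mat n n' \<Longrightarrow> kron A B \<in> carrier_mat (m * n) (m' * n')"
  unfolding kron_def carrier_mat_def by simp

lemma div_mod_less:
  fixes r :: nat
  assumes "r < m * n" shows "r div n < m" "r mod n < n"
proof -
  show "r div n < m" using assms by (rule less_mult_imp_div_less)
  have "n > 0" using assms by (metis mult_0_right not_less_zero gr0I)
  then show "r mod n < n" by simp
qed

lemma index_kron:
  assumes "A \<in> carrier_mat m m'" "B \<in> carrier_mat n n'" "i < m * n" "j < m' * n'"
  shows "kron A B $$ (i, j) = A $$ (i div n, j div n') * B $$ (i mod n, j mod n')"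
  using assms by (auto simp: kron_def)

lemma sum_lessThan_prod:
  fixes f :: "nat \<Rightarrow> complex"
  shows "(\<Sum>q<m * n. f q) = (\<Sum>a<m. \<Sum>b<n. f (a * n + b))"
proof -
  have "(\<Sum>q<m * n. f q) = (\<Sum>(a, b)\<in>{..<m} \<times> {..<n}. f (a * n + b))"
  proof (rule sum.reindex_bij_witness[of _ "\<lambda>(a, b). a * n + b" "\<lambda>q. (q div n, q mod n)"])
    fix ab assume "ab \<in> {..<m} \<times> {..<n}"
    then obtain a b where ab: "ab = (a, b)" "a < m" "b < n" by auto
    have "a * n + b < Suc a * n" using ab by simp
    also have "\<dots> \<le> m * n" using ab by (intro mult_right_mono) auto
    finally show "(case ab of (a, b) \<Rightarrow> a * n + b) \<in> {..<m * n}" using ab by simp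
  qed (auto dest: div_mod_less)
  then show ?thesis by (simp add: sum.cartesian_product)
qed

lemma kron_mult:
  assumes A: "A \<in> carrier_mat m m'" and B: "B \<in> carrier_mat n n'"
    and C: "C \<in> carrier_mat m' m''" and D: "D \<in> carrier_mat n' n''"
  shows "kron A B * kron C D = kron (A * C) (B * D)"
proof (rule eq_matI)
  fix i j assume "i < dim_row (kron (A * C) (B * D))" "j < dim_col (kron (A * C) (B * D))"
  then have ij: "i < m * n" "j < m'' * n''" using assms by (auto simp: kron_def)
  note dm = div_mod_less[OF ij(1)] div_mod_less[OF ij(2)]
  have "(kron A B * kron C D) $$ (i, j) = (\<Sum>q<m' * n'. kron A B $$ (i, q) * kron C D $$ (q, j))"
    using ij assms by (auto simp: kron_def scalar_prod_def lessThan_atLeast0)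
  also have "\<dots> = (\<Sum>q<m' * n'. (A $$ (i div n, q div n') * C $$ (q div n', j div n''))
      * (B $$ (i mod n, q mod n') * D $$ (q mod n', j mod n'')))"
    using ij by (intro sum.cong) (auto simp: index_kron[OF A B] index_kron[OF C D])
  also have "\<dots> = (\<Sum>a<m'. \<Sum>b<n'. (A $$ (i div n, a) * C $$ (a, j div n''))
      * (B $$ (i mod n, b) * D $$ (b, j mod n'')))"
    unfolding sum_lessThan_prod by (intro sum.cong) auto
  also have "\<dots> = (A * C) $$ (i div n, j div n'') * (B * D) $$ (i mod n, j mod n'')"
    using dm assms by (auto simp: scalar_prod_def lessThan_atLeast0 sum_product)
  also have "\<dots> = kron (A * C) (B * D) $$ (i, j)"
    using ij assms by (subst index_kron[of _ m m'' _ n n'']) auto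
  finally show "(kron A B * kron C D) $$ (i, j) = kron (A * C) (B * D) $$ (i, j)" .
qed (use assms in \<open>auto simp: kron_def\<close>)

lemma flip_mat_carrier [simp]: "flip_mat m n \<in> carrier_mat (n * m) (m * n)"
  by (simp add: flip_mat_def)

text \<open>Multiplication by a flip permutes rows or columns: position \<open>b * m + a\<close> in
  one order of the factors corresponds to \<open>a * n + b\<close> in the other. The two auxiliary
  facts state this with div and mod.\<close>

lemma flip_kron_flip:
  assumes A: "A \<in> carrier_mat m m" and B: "B \<in> carrier_mat n n"
  shows "flip_mat m n * kron A B * flip_mat n m = kron B A"
proof -
  have 1: "(flip_mat m n * C) $$ (i, j) = C $$ (i mod m * n + i div m, j)"
    if C: "C \<in> carrier_mat (m * n) k" and ij: "i < n * m" "j < k" for C i j k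
  proof -
    have "(flip_mat m n * C) $$ (i, j) = (\<Sum>q<m * n. flip_mat m n $$ (i, q) * C $$ (q, j))"
      using ij C by (auto simp: flip_mat_def scalar_prod_def lessThan_atLeast0)
    also have "\<dots> = (\<Sum>q<m * n. if i div m = q mod n \<and> i mod m = q div n then C $$ (q, j) else 0)"
      using ij by (intro sum.cong) (auto simp: flip_mat_def)
    also have "\<dots> = (\<Sum>a<m. \<Sum>b<n. if b = i div m then (if a = i mod m then C $$ (a * n + b, j) else 0) else 0)"
      unfolding sum_lessThan_prod by (intro sum.cong) auto
    also have "\<dots> = C $$ (i mod m * n + i div m, j)"
      using div_mod_less[OF ij(1)] by simp
    finally show ?thesis .
  qed
  have 2: "(C * flip_mat n m) $$ (i, j) = C $$ (i, j mod m * n + j div m)"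
    if C: "C \<in> carrier_mat k (m * n)" and ij: "i < k" "j < n * m" for C i j k
  proof -
    have "(C * flip_mat n m) $$ (i, j) = (\<Sum>q<m * n. C $$ (i, q) * flip_mat n m $$ (q, j))"
      using ij C by (auto simp: flip_mat_def scalar_prod_def lessThan_atLeast0)
    also have "\<dots> = (\<Sum>q<m * n. if q div n = j mod m \<and> q mod n = j div m then C $$ (i, q) else 0)"
      using ij by (intro sum.cong) (auto simp: flip_mat_def)
    also have "\<dots> = (\<Sum>a<m. \<Sum>b<n. if b = j div m then (if a = j mod m then C $$ (i, a * n + b) else 0) else 0)"
      unfolding sum_lessThan_prod by (intro sum.cong) auto
    also have "\<dots> = C $$ (i, j mod m * n + j div m)"
      using div_mod_less[OF ij(2)] by simp
    finally show ?thesis .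
  qed
  have less: "i mod m * n + i div m < m * n" if "i < n * m" for i
  proof -
    have "i mod m * n + i div m < Suc (i mod m) * n" using div_mod_less[OF that] by simp
    also have "\<dots> \<le> m * n" using div_mod_less[OF that] by (intro mult_right_mono) auto
    finally show ?thesis .
  qed
  show ?thesis
  proof (rule eq_matI)
    fix i j assume "i < dim_row (kron B A)" "j < dim_col (kron B A)"
    then have ij: "i < n * m" "j < n * m" using assms by (auto simp: kron_def)
    have "(flip_mat m n * kron A B * flip_mat n m) $$ (i, j)
        = (flip_mat m n * kron A B) $$ (i, j mod m * n + j div m)"
      by (rule 2[of _ "n * m"]) (use assms ij in \<open>auto intro!: mult_carrier_mat[of _ _ "m * n"]\<close>)
    also have "\<dots> = kron A B $$ (i mod m * n + i div m, j mod m * n + j div m)"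
      by (rule 1[of _ "m * n"]) (use assms ij less in auto)
    also have "\<dots> = kron B A $$ (i, j)"
      using ij less div_mod_less[OF ij(1)] div_mod_less[OF ij(2)]
      by (simp add: index_kron[OF A B] index_kron[OF B A])
    finally show "(flip_mat m n * kron A B * flip_mat n m) $$ (i, j) = kron B A $$ (i, j)" .
  qed (use assms in \<open>auto simp: kron_def flip_mat_def\<close>)
qed

text \<open>Unlike a sum in the algebra of matrices, this is defined without fixing a ring of
  matrices of given size.\<close>

definition mat_sum :: "nat \<Rightarrow> nat \<Rightarrow> ('i \<Rightarrow> complex mat) \<Rightarrow> 'i set \<Rightarrow> complex mat" where
  "mat_sum m n f S = mat m n (\<lambda>rc. \<Sum>x\<in>S. f x $$ rc)"

lemma mat_sum_carrier [simp]: "mat_sum m n f S \<in> carrier_mat m n"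
  by (simp add: mat_sum_def)

lemma mat_sum_mult_left:
  assumes A: "A \<in> carrier_mat k m" and f: "\<And>x. x \<in> S \<Longrightarrow> f x \<in> carrier_mat m n"
  shows "A * mat_sum m n f S = mat_sum k n (\<lambda>x. A * f x) S"
proof (rule eq_matI)
  fix i j assume "i < dim_row (mat_sum k n (\<lambda>x. A * f x) S)" "j < dim_col (mat_sum k n (\<lambda>x. A * f x) S)"
  then have ij: "i < k" "j < n" by (auto simp: mat_sum_def)
  have "(A * mat_sum m n f S) $$ (i, j) = (\<Sum>q = 0..<m. A $$ (i, q) * (\<Sum>x\<in>S. f x $$ (q, j)))"
    using A ij by (auto simp: mat_sum_def scalar_prod_def)
  also have "\<dots> = (\<Sum>x\<in>S. \<Sum>q = 0..<m. A $$ (i, q) * f x $$ (q, j))"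
    unfolding sum_distrib_left by (rule sum.swap)
  also have "\<dots> = (\<Sum>x\<in>S. (A * f x) $$ (i, j))"
  proof (rule sum.cong)
    fix x assume "x \<in> S"
    then show "(\<Sum>q = 0..<m. A $$ (i, q) * f x $$ (q, j)) = (A * f x) $$ (i, j)"
      using A ij f[of x] by (auto simp: scalar_prod_def)
  qed simp
  finally show "(A * mat_sum m n f S) $$ (i, j) = mat_sum k n (\<lambda>x. A * f x) S $$ (i, j)"
    using ij by (simp add: mat_sum_def)
qed (use A in \<open>auto simp: mat_sum_def\<close>)

lemma mat_sum_mult_right:
  assumes A: "A \<in> carrier_mat n k" and f: "\<And>x. x \<in> S \<Longrightarrow> f x \<in> carrier_mat m n"
  shows "mat_sum m n f S * A = mat_sum m k (\<lambda>x. f x * A) S"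
proof (rule eq_matI)
  fix i j assume "i < dim_row (mat_sum m k (\<lambda>x. f x * A) S)" "j < dim_col (mat_sum m k (\<lambda>x. f x * A) S)"
  then have ij: "i < m" "j < k" by (auto simp: mat_sum_def)
  have "(mat_sum m n f S * A) $$ (i, j) = (\<Sum>q = 0..<n. (\<Sum>x\<in>S. f x $$ (i, q)) * A $$ (q, j))"
    using A ij by (auto simp: mat_sum_def scalar_prod_def)
  also have "\<dots> = (\<Sum>x\<in>S. \<Sum>q = 0..<n. f x $$ (i, q) * A $$ (q, j))"
    unfolding sum_distrib_right by (rule sum.swap)
  also have "\<dots> = (\<Sum>x\<in>S. (f x * A) $$ (i, j))"
  proof (rule sum.cong)
    fix x assume "x \<in> S"
    then show "(\<Sum>q = 0..<n. f x $$ (i, q) * A $$ (q, j)) = (f x * A) $$ (i, j)"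
      using A ij f[of x] by (auto simp: scalar_prod_def)
  qed simp
  finally show "(mat_sum m n f S * A) $$ (i, j) = mat_sum m k (\<lambda>x. f x * A) S $$ (i, j)"
    using ij by (simp add: mat_sum_def)
qed (use A in \<open>auto simp: mat_sum_def\<close>)

lemma mat_sum_cong:
  "(\<And>x. x \<in> S \<Longrightarrow> f x = g x) \<Longrightarrow> mat_sum m n f S = mat_sum m n g S"
  unfolding mat_sum_def by (intro arg_cong[of _ _ "mat m n"] ext sum.cong) auto

lemma mat_sum_mat_sum:
  "mat_sum m n (\<lambda>x. mat_sum m n (f x) S') S = mat_sum m n (\<lambda>(x, y). f x y) (S \<times> S')"
  by (rule eq_matI) (auto simp: mat_sum_def sum.cartesian_product case_prod_unfold)

lemma mat_sum_mult:
  assumes f: "\<And>x. x \<in> S \<Longrightarrow> f x \<in> carrier_mat m n" and g: "\<And>x. x \<in> S' \<Longrightarrow> g x \<in> carrier_mat n k"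
  shows "mat_sum m n f S * mat_sum n k g S' = mat_sum m k (\<lambda>(x, y). f x * g y) (S \<times> S')"
  unfolding mat_sum_mat_sum [symmetric]
  by (subst mat_sum_mult_right[OF _ f]) (auto intro!: mat_sum_cong mat_sum_mult_left[OF f g])

lemma ptrace_right_kron:
  assumes A: "A \<in> carrier_mat m m" and B: "B \<in> carrier_mat n n" and rc: "r < m" "c < m"
  shows "(\<Sum>j<n. kron A B $$ (r * n + j, c * n + j)) = A $$ (r, c) * mat_trace B"
proof -
  have "r * n + j < m * n" if "r < m" "j < n" for r j
  proof -
    have "r * n + j < Suc r * n" using that by simp
    also have "\<dots> \<le> m * n" using that by (intro mult_right_mono) auto
    finally show ?thesis .
  qed
  then show ?thesis
    using assms by (auto simp: index_kron[OF A B] mat_trace_def sum_distrib_left intro!: sum.cong)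
qed

lemma ptrace_left_kron:
  assumes A: "A \<in> carrier_mat m m" and B: "B \<in> carrier_mat n n" and rc: "r < n" "c < n"
  shows "(\<Sum>i<m. kron A B $$ (i * n + r, i * n + c)) = mat_trace A * B $$ (r, c)"
proof -
  have "i * n + r < m * n" if "i < m" "r < n" for i r
  proof -
    have "i * n + r < Suc i * n" using that by simp
    also have "\<dots> \<le> m * n" using that by (intro mult_right_mono) auto
    finally show ?thesis .
  qed
  then show ?thesis
    using assms by (auto simp: index_kron[OF A B] mat_trace_def sum_distrib_right intro!: sum.cong)
qed

section \<open>The double braiding as a sum over two copies of the R-matrix\<close>

definition "R_index d = {..<d} \<times> {..<d} \<times> {..<(d::nat)}"

lemma tau_R_eq:
  assumes N: "\<And>i k. R_right d N i k \<in> carrier_mat (mdim N) (mdim N)"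
    and M: "\<And>i j. R_left M i j \<in> carrier_mat (mdim M) (mdim M)"
  shows "tau_R d \<zeta> N M = mat_sum (mdim N * mdim M) (mdim N * mdim M)
     (\<lambda>(i, j, k). R_coeff d \<zeta> i j k \<cdot>\<^sub>m kron (R_right d N i k) (R_left M i j)) (R_index d)"
proof (rule eq_matI, goal_cases)
  case (1 r c)
  have "kron (R_right d N i k) (R_left M i j) \<in> carrier_mat (mdim N * mdim M) (mdim N * mdim M)" for i j k
    using N M by simp
  then have d: "dim_row (kron (R_right d N i k) (R_left M i j)) = mdim N * mdim M"
    "dim_col (kron (R_right d N i k) (R_left M i j)) = mdim N * mdim M" for i j k
    by blast+
  have rc: "r < mdim N * mdim M" "c < mdim N * mdim M" using 1 by (simp_all add: mat_sum_def)
  then show ?case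
    by (simp add: tau_R_def mat_sum_def R_index_def sum.cartesian_product case_prod_unfold d)
qed (auto simp: tau_R_def mat_sum_def)

text \<open>The flips conjugate the action of tau(R) on the tensor product of \<open>M\<close> and
  \<open>L\<close> into the action of R on that of \<open>L\<close> and \<open>M\<close>, which
  leaves tau(R)R. Unprimed indices belong to tau(R), primed ones to R.\<close>

lemma braiding_square:
  fixes M L :: db_module and d :: nat and \<zeta> :: complex
  defines "m \<equiv> mdim M" and "l \<equiv> mdim L"
  assumes M: "\<And>i k. R_right d M i k \<in> carrier_mat m m" "\<And>i j. R_left M i j \<in> carrier_mat m m"
    and L: "\<And>i k. R_right d L i k \<in> carrier_mat l l" "\<And>i j. R_left L i j \<in> carrier_mat l l"
  shows "braiding d \<zeta> M L * braiding d \<zeta> L M = mat_sum (l * m) (l * m)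
     (\<lambda>((i, j, k), (i', j', k')). (R_coeff d \<zeta> i j k * R_coeff d \<zeta> i' j' k') \<cdot>\<^sub>m
        kron (R_right d L i k * R_left L i' j') (R_left M i j * R_right d M i' k')) (R_index d \<times> R_index d)"
proof -
  note carr = M L
  define f where "f = (\<lambda>(i, j, k). R_coeff d \<zeta> i j k \<cdot>\<^sub>m kron (R_right d L i k) (R_left M i j))"
  define g where "g = (\<lambda>(i, j, k). R_coeff d \<zeta> i j k \<cdot>\<^sub>m kron (R_right d M i k) (R_left L i j))"
  have f: "f x \<in> carrier_mat (l * m) (l * m)" and g: "g x \<in> carrier_mat (m * l) (m * l)" for x
    using carr by (auto simp: f_def g_def split: prod.splits)
  have tau: "tau_R d \<zeta> L M = mat_sum (l * m) (l * m) f (R_index d)"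
     "tau_R d \<zeta> M L = mat_sum (m * l) (m * l) g (R_index d)"
    unfolding f_def g_def using carr unfolding l_def m_def by (simp_all add: tau_R_eq)
  have [simp]: "flip_mat m l \<in> carrier_mat (l * m) (m * l)" "flip_mat l m \<in> carrier_mat (m * l) (l * m)" by simp_all
  have "braiding d \<zeta> M L * braiding d \<zeta> L M
      = tau_R d \<zeta> L M * (flip_mat m l * tau_R d \<zeta> M L * flip_mat l m)"
    unfolding braiding_def l_def [symmetric] m_def [symmetric] tau
    by (subst assoc_mult_mat[of _ "l * m" "l * m" _ "m * l" _ "l * m"])
      (auto intro!: mult_carrier_mat[of _ _ "m * l"] arg_cong[of _ _ "\<lambda>X. A * X" for A]
        assoc_mult_mat[of _ "l * m" "m * l" _ "m * l" _ "l * m", symmetric])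
  also have "flip_mat m l * tau_R d \<zeta> M L * flip_mat l m
      = mat_sum (l * m) (l * m) (\<lambda>x. flip_mat m l * g x * flip_mat l m) (R_index d)"
    unfolding tau using g
    by (subst mat_sum_mult_left[of _ "l * m"]; (subst mat_sum_mult_right[of _ _ "l * m"])?)
      (auto intro!: mult_carrier_mat[of _ _ "m * l"])
  also have "\<dots> = mat_sum (l * m) (l * m)
      (\<lambda>(i, j, k). R_coeff d \<zeta> i j k \<cdot>\<^sub>m kron (R_left L i j) (R_right d M i k)) (R_index d)"
  proof (rule mat_sum_cong, clarify)
    fix i j k
    show "flip_mat m l * g (i, j, k) * flip_mat l m = R_coeff d \<zeta> i j k \<cdot>\<^sub>m kron (R_left L i j) (R_right d M i k)"
      using flip_kron_flip[OF M(1) L(2), of i k i j] carr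
      by (simp add: g_def mult_smult_distrib[of _ "l * m" "m * l" _ "m * l"]
          mult_smult_assoc_mat[of _ "l * m" "m * l" _ "l * m"] mult_carrier_mat[of _ "l * m" "m * l" _ "m * l"])
  qed
  also have "tau_R d \<zeta> L M * \<dots> = mat_sum (l * m) (l * m) (\<lambda>(x, y). f x *
       (case y of (i, j, k) \<Rightarrow> R_coeff d \<zeta> i j k \<cdot>\<^sub>m kron (R_left L i j) (R_right d M i k))) (R_index d \<times> R_index d)"
    unfolding tau by (rule mat_sum_mult) (use f carr in auto)
  also have "\<dots> = mat_sum (l * m) (l * m)
     (\<lambda>((i, j, k), (i', j', k')). (R_coeff d \<zeta> i j k * R_coeff d \<zeta> i' j' k') \<cdot>\<^sub>m
        kron (R_right d L i k * R_left L i' j') (R_left M i j * R_right d M i' k')) (R_index d \<times> R_index d)"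
  proof (rule mat_sum_cong, clarify)
    fix i j k i' j' k'
    show "f (i, j, k) * (R_coeff d \<zeta> i' j' k' \<cdot>\<^sub>m kron (R_left L i' j') (R_right d M i' k'))
      = (R_coeff d \<zeta> i j k * R_coeff d \<zeta> i' j' k') \<cdot>\<^sub>m
        kron (R_right d L i k * R_left L i' j') (R_left M i j * R_right d M i' k')"
      using carr
      by (simp add: f_def mult_smult_distrib[of _ "l * m" "l * m" _ "l * m"] kron_mult[of _ l l _ m m _ l _ m]
          mult_smult_assoc_mat[of _ "l * m" "l * m" _ "l * m"] smult_smult_times mult.commute)
  qed
  finally show ?thesis .
qed

section \<open>The scalars of the partial quantum traces\<close>

text \<open>Meant for the four Cartan exponents of the double braiding: \<open>a\<close> and
  \<open>a'\<close> are those of \<open>K\<close> on \<open>M\<close>, while \<open>b\<close> and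
  \<open>b'\<close> produce only characters.\<close>

lemma fourier_inversion_twice:
  fixes g :: "int \<Rightarrow> int \<Rightarrow> complex"
  assumes "primitive_root_unity d \<zeta>" "d > 0"
    and g: "\<And>x y. g (x mod int d) y = g x y" "\<And>x y. g x (y mod int d) = g x y"
  shows "(\<Sum>a<d. \<Sum>b<d. \<Sum>a'<d. \<Sum>b'<d. \<zeta> powi (int b * (u - int a) + int b' * (v - int a')) * g (int a) (int a'))
    = of_nat d * of_nat d * g u v"
proof -
  have nz: "\<zeta> \<noteq> 0" using primitive_root_nonzero assms by blast
  have "(\<Sum>a'<d. \<Sum>b'<d. \<zeta> powi (int b * (u - int a) + int b' * (v - int a')) * g (int a) (int a'))
      = \<zeta> powi (int b * (u - int a)) * (of_nat d * g (int a) v)" for a b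
    using fourier_inversion[OF assms(1,2), of "g (int a)" v] nz g(2)
    by (simp add: power_int_add mult.assoc sum_distrib_left [symmetric])
  then show ?thesis
    using fourier_inversion[OF assms(1,2), of "\<lambda>x. of_nat d * g x v" u] g(1) by simp
qed

lemma scalar_of_smult_one:
  assumes "m > 0" shows "scalar_of (c \<cdot>\<^sub>m 1\<^sub>m m) = c"
  unfolding scalar_of_def
proof (rule the_equality)
  fix x assume "c \<cdot>\<^sub>m 1\<^sub>m m = x \<cdot>\<^sub>m 1\<^sub>m (dim_row (c \<cdot>\<^sub>m 1\<^sub>m m))"
  then have "(c \<cdot>\<^sub>m 1\<^sub>m m) $$ (0, 0) = (x \<cdot>\<^sub>m 1\<^sub>m m) $$ (0, 0)" by simp
  then show "x = c" using assms by simp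
qed simp

lemma pow_smult_one:
  "(x \<cdot>\<^sub>m 1\<^sub>m m) ^\<^sub>m k = x ^ k \<cdot>\<^sub>m 1\<^sub>m m" for x :: complex
  by (induction k) (auto simp: mat_eq_iff mult_smult_distrib[of _ m m _ m] mult.commute)

lemma index_mult_mat_sum:
  assumes "A \<in> carrier_mat m k" "B \<in> carrier_mat k n" "i < m" "j < n"
  shows "(A * B) $$ (i, j) = (\<Sum>q<k. A $$ (i, q) * B $$ (q, j))"
  using assms by (auto simp: scalar_prod_def lessThan_atLeast0)

section \<open>Powers of the generators on the simple module\<close>

locale db_rep_simple = db_rep +
  fixes l p :: int
  assumes l: "1 \<le> l" "l \<le> int d"
begin

abbreviation "L \<equiv> simple_module \<zeta> (l, p)"
text \<open>The vector of \<open>L\<close> with index \<open>c\<close> (which is \<open>e\<close> with subscript \<open>c + 1\<close>) has weight \<open>wt c\<close>, and \<open>E\<close>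
  sends it to \<open>\<phi> c\<close> times its predecessor.\<close>

definition "m = nat l"
definition "s = 2 * p + l - 1"
definition "wt c = p + l - 1 - int c"
definition "\<phi> x = \<zeta> powi p * ((\<zeta> powi x - 1) / (\<zeta> - 1)) * (\<zeta> powi (l - x) - 1)"
text \<open>The coefficient of \<open>E^i\<close> at the vector of index \<open>x\<close>. Like
  \<open>\<phi>\<close>, which has the q-integer in closed form, it makes sense for every integer
  \<open>x\<close>: the minus sign evaluates it at \<open>c + i\<close>, possibly beyond the last
  index, and \<open>\<phi>\<close> also meets negative arguments.\<close>

definition "\<Phi> x i = (\<Prod>t<(i::nat). \<phi> (x - int t))"

lemma m: "0 < m" "int m = l" "m \<le> d"
  using l by (auto simp: m_def)

lemma L_sel:
  "mdim L = m"
  "actE L = mat m m (\<lambda>(r, c). if c = Suc r then \<phi> (int c) else 0)"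
  "actF L = mat m m (\<lambda>(r, c). if r = Suc c then 1 else 0)"
  "actK L = mat m m (\<lambda>(r, c). if r = c then \<zeta> powi (wt c) else 0)"
  "actZ L = \<zeta> powi s \<cdot>\<^sub>m 1\<^sub>m m"
proof -
  have "\<zeta> powi p * qint \<zeta> c * (\<zeta> powi (l - int c) - 1) = \<phi> (int c)" for c
    using zeta_neq_1 by (simp add: \<phi>_def qint_eq)
  moreover have "p + l - int (Suc c) = wt c" for c by (simp add: wt_def)
  ultimately show "mdim L = m"
    "actE L = mat m m (\<lambda>(r, c). if c = Suc r then \<phi> (int c) else 0)"
    "actF L = mat m m (\<lambda>(r, c). if r = Suc c then 1 else 0)"
    "actK L = mat m m (\<lambda>(r, c). if r = c then \<zeta> powi (wt c) else 0)"
    "actZ L = \<zeta> powi s \<cdot>\<^sub>m 1\<^sub>m m"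
    by (simp_all only: simple_module_def prod.case m_def [symmetric] Let_def db_module.simps s_def)
qed

lemma \<phi>_0: "\<phi> 0 = 0" and \<phi>_l: "\<phi> l = 0"
  by (simp_all add: \<phi>_def)

text \<open>The formula for \<open>[E, F^(i+1)]\<close> read at the vector of index
  \<open>x - i\<close>, where \<open>E F^(i+1)\<close> contributes \<open>\<phi> (x + 1)\<close> and
  \<open>F^(i+1) E\<close> contributes \<open>\<phi> (x - i)\<close>. The closed form proves it for
  all integers \<open>x\<close>.\<close>

lemma \<phi>_diff:
  "\<phi> (x + 1) - \<phi> (x - int i) = qint \<zeta> (Suc i) * (\<zeta> powi (p + l - 1 - x) - \<zeta> powi (p + x - int i))"
proof -
  define A B C I where "A = \<zeta> powi x" and "B = \<zeta> powi (l - x)" and "C = \<zeta> powi p" and "I = \<zeta> ^ i"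
  have nz: "A \<noteq> 0" "B \<noteq> 0" "C \<noteq> 0" "I \<noteq> 0" "\<zeta> \<noteq> 0" "\<zeta> - 1 \<noteq> 0"
    using zeta_nz zeta_neq_1 by (auto simp: A_def B_def C_def I_def)
  have e: "\<zeta> powi (x + 1) = A * \<zeta>" "\<zeta> powi (x - int i) = A / I" "\<zeta> powi (l - (x + 1)) = B / \<zeta>"
    "\<zeta> powi (l - (x - int i)) = B * I" "\<zeta> powi (p + l - 1 - x) = C * B / \<zeta>" "\<zeta> powi (p + x - int i) = C * A / I"
    using nz by (simp_all add: zeta_add zeta_diff A_def B_def C_def I_def)
  have q: "qint \<zeta> (Suc i) = (\<zeta> * I - 1) / (\<zeta> - 1)"
    using zeta_neq_1 by (simp add: qint_eq I_def)
  have "C * ((A * \<zeta> - 1) / (\<zeta> - 1)) * (B / \<zeta> - 1) - C * ((A / I - 1) / (\<zeta> - 1)) * (B * I - 1)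
     = (\<zeta> * I - 1) / (\<zeta> - 1) * (C * B / \<zeta> - C * A / I)"
    using nz by (simp add: divide_simps) (simp add: algebra_simps)
  then show ?thesis unfolding \<phi>_def e q C_def [symmetric] .
qed

lemma \<Phi>_Suc: "\<Phi> x (Suc i) = \<Phi> x i * \<phi> (x - int i)"
  by (simp add: \<Phi>_def)

lemma \<Phi>_Suc_shift: "\<Phi> (x + 1) (Suc i) = \<phi> (x + 1) * \<Phi> x i"
  by (simp add: \<Phi>_def prod.lessThan_Suc_shift del: prod.lessThan_Suc)

text \<open>The factors of \<open>\<Phi> x i\<close> have the arguments \<open>x\<close>,
  \<open>x - 1\<close>, ..., \<open>x - i + 1\<close>; one zero of \<open>\<phi>\<close> in this
  window suffices. In the applications the zero is 0 or \<open>l\<close>.\<close>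

lemma \<Phi>_eq_0:
  assumes "\<phi> y = 0" "y \<le> x" "x < y + int i"
  shows "\<Phi> x i = 0"
proof -
  have "nat (x - y) < i" "x - int (nat (x - y)) = y" using assms by auto
  then show ?thesis using assms(1) unfolding \<Phi>_def by (intro prod_zero) (auto intro!: bexI[of _ "nat (x - y)"])
qed

lemma L_carrier [simp]:
  "actE L \<in> carrier_mat m m" "actF L \<in> carrier_mat m m" "actK L \<in> carrier_mat m m" "actZ L \<in> carrier_mat m m"
  by (simp_all add: L_sel)

lemma L_E_pow: "actE L ^\<^sub>m i = mat m m (\<lambda>(r, c). if c = r + i then \<Phi> (int c) i else 0)"
proof (induction i)
  case 0
  show ?case using L_carrier(1) by (auto simp: \<Phi>_def mat_eq_iff L_sel)
next
  case (Suc i)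
  show ?case
  proof (rule eq_matI, goal_cases)
    case (1 r c)
    then have rc: "r < m" "c < m" by auto
    have "(actE L ^\<^sub>m Suc i) $$ (r, c) = (\<Sum>q<m. actE L $$ (r, q) * (actE L ^\<^sub>m i) $$ (q, c))"
      by (subst pow_mat_Suc_left[of _ m]) (use rc in \<open>simp_all add: index_mult_mat_sum[of _ m m _ m]\<close>)
    also have "\<dots> = (\<Sum>q<m. if q = Suc r then (if c = Suc r + i then \<phi> (int (Suc r)) * \<Phi> (int c) i else 0) else 0)"
      unfolding Suc using rc by (intro sum.cong) (auto simp: L_sel)
    also have "\<dots> = (if c = r + Suc i then \<Phi> (int c) (Suc i) else 0)"
      using rc by (auto simp: \<Phi>_Suc)
    finally show ?case using rc by simp
  qed (use L_carrier(1) in \<open>auto simp: L_sel\<close>)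
qed

lemma L_F_pow: "actF L ^\<^sub>m i = mat m m (\<lambda>(r, c). if r = c + i then 1 else 0)"
proof (induction i)
  case 0
  show ?case by (auto simp: mat_eq_iff L_sel)
next
  case (Suc i)
  show ?case
  proof (rule eq_matI, goal_cases)
    case (1 r c)
    then have rc: "r < m" "c < m" by auto
    have "(actF L ^\<^sub>m Suc i) $$ (r, c) = (\<Sum>q<m. actF L $$ (r, q) * (actF L ^\<^sub>m i) $$ (q, c))"
      by (subst pow_mat_Suc_left[of _ m]) (use rc in \<open>simp_all add: index_mult_mat_sum[of _ m m _ m]\<close>)
    also have "\<dots> = (\<Sum>q<m. if q = c + i then (if r = c + Suc i then 1 else 0) else 0)"
      unfolding Suc using rc by (intro sum.cong) (auto simp: L_sel)
    also have "\<dots> = (if r = c + Suc i then 1 else 0)"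
      using rc by auto
    finally show ?case using rc by simp
  qed (auto simp: L_sel)
qed

lemma L_K_pow: "actK L ^\<^sub>m j = mat m m (\<lambda>(r, c). if r = c then \<zeta> powi (int j * wt c) else 0)"
proof (induction j)
  case 0
  show ?case by (auto simp: mat_eq_iff L_sel)
next
  case (Suc j)
  show ?case
  proof (rule eq_matI, goal_cases)
    case (1 r c)
    then have rc: "r < m" "c < m" by auto
    have "(actK L ^\<^sub>m Suc j) $$ (r, c) = (\<Sum>q<m. (actK L ^\<^sub>m j) $$ (r, q) * actK L $$ (q, c))"
      using rc by (simp add: index_mult_mat_sum[of _ m m _ m])
    also have "\<dots> = (\<Sum>q<m. if q = c then (if r = c then \<zeta> powi (int j * wt c) * \<zeta> powi (wt c) else 0) else 0)"
      unfolding Suc using rc by (intro sum.cong) (auto simp: L_sel)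
    also have "\<dots> = (if r = c then \<zeta> powi (int (Suc j) * wt c) else 0)"
      using rc by (auto simp: zeta_add [symmetric] algebra_simps)
    finally show ?case using rc by simp
  qed (auto simp: L_sel)
qed

lemma L_Z: "zpow d (actZ L) (- int k) = \<zeta> powi (- (int k * s)) \<cdot>\<^sub>m 1\<^sub>m m"
proof -
  have "zpow d (actZ L) (- int k) = (\<zeta> powi s) ^ nat (- int k mod int d) \<cdot>\<^sub>m 1\<^sub>m m"
    by (simp add: zpow_def L_sel pow_smult_one)
  also have "(\<zeta> powi s) ^ nat (- int k mod int d) = (\<zeta> powi s) powi (- int k mod int d)"
    using d_pos by (metis int_nat_eq pos_mod_sign of_nat_0_less_iff power_int_of_nat)
  also have "\<dots> = (\<zeta> powi s) powi (- int k)"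
  proof (rule root_unity_powi_mod)
    show "(\<zeta> powi s) ^ d = 1"
      by (metis mult.commute power_int_mult power_int_of_nat zeta_pow_d power_int_1_left)
  qed (rule d_pos)
  also have "\<dots> = \<zeta> powi (- (int k * s))"
    by (simp add: power_int_mult [symmetric] mult.commute)
  finally show ?thesis .
qed

lemma L_R_left: "R_left L i j = mat m m (\<lambda>(r, c). if c = r + i then \<Phi> (int c) i * \<zeta> powi (int j * wt c) else 0)"
proof (rule eq_matI, goal_cases)
  case (1 r c)
  then have rc: "r < m" "c < m" by auto
  have "R_left L i j $$ (r, c) = (\<Sum>q<m. (actE L ^\<^sub>m i) $$ (r, q) * (actK L ^\<^sub>m j) $$ (q, c))"
    unfolding R_left_def using rc by (simp add: index_mult_mat_sum[of _ m m _ m])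
  also have "\<dots> = (\<Sum>q<m. if q = c then (if c = r + i then \<Phi> (int c) i * \<zeta> powi (int j * wt c) else 0) else 0)"
    unfolding L_E_pow L_K_pow using rc by (intro sum.cong) auto
  finally show ?case using rc by simp
qed (auto simp: R_left_def L_sel)

lemma L_R_right: "R_right d L i k = mat m m (\<lambda>(r, c). if r = c + i then \<zeta> powi (int k * (wt c - s)) else 0)"
proof (rule eq_matI, goal_cases)
  case (1 r c)
  then have rc: "r < m" "c < m" by auto
  have "R_right d L i k = \<zeta> powi (- (int k * s)) \<cdot>\<^sub>m (actF L ^\<^sub>m i * actK L ^\<^sub>m k)"
    unfolding R_right_def L_Z
    by (simp add: assoc_mult_mat[of _ m m _ m _ m] mult_smult_assoc_mat[of _ m m _ m]
        left_mult_one_mat[of _ m m])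
  moreover have "actF L ^\<^sub>m i * actK L ^\<^sub>m k \<in> carrier_mat m m"
    by (intro mult_carrier_mat[of _ m m] pow_carrier_mat L_carrier)
  ultimately have "R_right d L i k $$ (r, c)
      = \<zeta> powi (- (int k * s)) * (actF L ^\<^sub>m i * actK L ^\<^sub>m k) $$ (r, c)"
    using rc by (metis carrier_matD index_smult_mat(1))
  also have "\<dots>
      = \<zeta> powi (- (int k * s)) * (\<Sum>q<m. (actF L ^\<^sub>m i) $$ (r, q) * (actK L ^\<^sub>m k) $$ (q, c))"
    using rc by (subst index_mult_mat_sum[of _ m m _ m]) (simp_all only: pow_carrier_mat L_carrier)
  also have "\<dots> = \<zeta> powi (- (int k * s)) * (\<Sum>q<m. if q = c then (if r = c + i then \<zeta> powi (int k * wt c) else 0) else 0)"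
    unfolding L_F_pow L_K_pow using rc by (intro arg_cong2[of _ _ _ _ "(*)"] sum.cong) auto
  also have "\<dots> = (if r = c + i then \<zeta> powi (int k * (wt c - s)) else 0)"
    using rc by (auto simp: zeta_add [symmetric] algebra_simps)
  finally show ?case using rc by simp
qed (auto simp: R_right_def L_sel zpow_def)

lemma L_right_left:
  assumes "r < m" "c < m"
  shows "(R_right d L i k * R_left L i j) $$ (r, c)
    = (if r = c then \<Phi> (int c) i * \<zeta> powi (int j * wt c + int k * (wt c + int i - s)) else 0)"
proof -
  have "(R_right d L i k * R_left L i j) $$ (r, c) = (\<Sum>q<m. R_right d L i k $$ (r, q) * R_left L i j $$ (q, c))"
    using assms by (subst index_mult_mat_sum[of _ m m _ m]) (auto simp: L_R_left L_R_right)
  also have "\<dots> = (\<Sum>q<m. if q = c - i then (if r = c \<and> i \<le> c then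
      \<Phi> (int c) i * \<zeta> powi (int j * wt c + int k * (wt c + int i - s)) else 0) else 0)"
    unfolding L_R_left L_R_right using assms
    by (intro sum.cong) (auto simp: zeta_add [symmetric] wt_def algebra_simps)
  also have "\<dots> = (if r = c \<and> i \<le> c then
      \<Phi> (int c) i * \<zeta> powi (int j * wt c + int k * (wt c + int i - s)) else 0)"
    using assms by (simp add: less_imp_diff_less)
  also have "\<dots> = (if r = c then \<Phi> (int c) i * \<zeta> powi (int j * wt c + int k * (wt c + int i - s)) else 0)"
    using \<Phi>_eq_0[OF \<phi>_0, of "int c" i] by auto
  finally show ?thesis .
qed

lemma L_left_right:
  assumes "r < m" "c < m"
  shows "(R_left L i j * R_right d L i k) $$ (r, c)
    = (if r = c then \<Phi> (int c + int i) i * \<zeta> powi (int j * (wt c - int i) + int k * (wt c - s)) else 0)"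
proof -
  have "(R_left L i j * R_right d L i k) $$ (r, c) = (\<Sum>q<m. R_left L i j $$ (r, q) * R_right d L i k $$ (q, c))"
    using assms by (subst index_mult_mat_sum[of _ m m _ m]) (auto simp: L_R_left L_R_right)
  also have "\<dots> = (\<Sum>q<m. if q = c + i then (if r = c then
      \<Phi> (int c + int i) i * \<zeta> powi (int j * (wt c - int i) + int k * (wt c - s)) else 0) else 0)"
    unfolding L_R_left L_R_right using assms
    by (intro sum.cong) (auto simp: zeta_add [symmetric] wt_def algebra_simps)
  \<comment> \<open>If \<open>c + i\<close> lies beyond the last index, no \<open>q\<close>
    contributes to the sum; on the right \<open>\<Phi>\<close> vanishes because its window contains
    \<open>l\<close>.\<close>
  also have "\<dots> = (if r = c then \<Phi> (int c + int i) i * \<zeta> powi (int j * (wt c - int i) + int k * (wt c - s)) else 0)"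
    using \<Phi>_eq_0[OF \<phi>_l, of "int c + int i" i] assms m by (auto simp: not_less)
  finally show ?thesis .
qed

section \<open>Traces on \<open>M\<close> of words from the R-matrix\<close>

lemma R_left_H: "R_left M i j = E ^\<^sub>m i * H (int j) 0"
  by (simp add: R_left_def K_pow)

lemma R_right_H: "R_right d M i k = H 0 (- int k) * (F ^\<^sub>m i * H (int k) 0)"
  by (simp add: R_right_def K_pow Z_zpow)

lemma pivot_H: "pivot d M = H 1 (-1)"
  using K_H by (simp add: pivot_def Z_zpow H_add flip: K_H) (metis H_add add_0 K_H add.right_neutral)

lemma pivot_inv_H: "pivot_inv d M = H (-1) 1"
  unfolding pivot_inv_def K_zpow by (subst Z_H) (simp add: H_add)

text \<open>Conjugation by \<open>K\<close> multiplies the word by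
  \<open>\<zeta> powi (int i - int i')\<close> and preserves its trace. As both powers are below
  \<open>d\<close>, this factor is 1 only for \<open>i = i'\<close>.\<close>

lemma tr_E_F_eq_0:
  assumes "i \<noteq> i'" "i < d" "i' < d"
  shows "tr (E ^\<^sub>m i * (H b c * (F ^\<^sub>m i' * H b' c'))) = 0"
proof -
  let ?w = "E ^\<^sub>m i * (H b c * (F ^\<^sub>m i' * H b' c'))"
  have "H 1 0 * ?w = \<zeta> powi (int i - int i') \<cdot>\<^sub>m (?w * H 1 0)"
  proof (rule mat_eq_by_trace)
    fix X :: "complex mat" assume [simp]: "X \<in> carrier_mat n n"
    have "tr (X * (H 1 0 * ?w)) = \<zeta> powi int i * tr (X * E ^\<^sub>m i * H b c * (H 1 0 * (F ^\<^sub>m i' * H b' c')))"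
      by (subst tr_HE_pow) (simp_all add: H_add add.commute del: power_int_of_nat flip: assoc[of "H _ _" "H _ _"])
    also have "\<dots> = \<zeta> powi int i * (\<zeta> powi (- int i') * tr (X * (?w * H 1 0)))"
      by (subst tr_HF_pow) (simp_all add: H_add add.commute)
    finally show "tr (X * (H 1 0 * ?w)) = tr (X * (\<zeta> powi (int i - int i') \<cdot>\<^sub>m (?w * H 1 0)))"
      using zeta_add[of "int i" "- int i'"] by (simp add: distribs)
  qed simp_all
  note comm = this
  have "tr ?w = tr ((H (-1) 0 * H 1 0) * ?w)" by (simp add: H_add)
  also have "\<dots> = tr (H (-1) 0 * (H 1 0 * ?w))" by simp
  also have "\<dots> = \<zeta> powi (int i - int i') * tr (H (-1) 0 * (?w * H 1 0))"
    unfolding comm by (simp add: distribs)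
  also have "tr (H (-1) 0 * (?w * H 1 0)) = tr (?w * H 1 0 * H (-1) 0)"
    by (rule tr_cyc) simp_all
  also have "\<dots> = tr ?w" by (simp add: H_add)
  finally have "(\<zeta> powi (int i - int i') - 1) * tr ?w = 0" by (simp add: algebra_simps)
  moreover have "\<not> int d dvd int i - int i'"
    using assms zdvd_imp_le[of "int d" "int i - int i'"] zdvd_imp_le[of "int d" "int i' - int i"]
    by (auto simp: dvd_diff_commute linorder_neq_iff)
  then have "\<zeta> powi (int i - int i') \<noteq> 1"
    using primitive_root_powi_eq_1_iff[OF primitive d_pos] by blast
  ultimately show ?thesis by simp
qed

lemma tr_F_E_eq_0:
  assumes "i \<noteq> i'" "i < d" "i' < d"
  shows "tr (F ^\<^sub>m i * (H b c * (E ^\<^sub>m i' * H b' c'))) = 0"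
proof -
  have "tr (F ^\<^sub>m i * (H b c * (E ^\<^sub>m i' * H b' c'))) = tr ((F ^\<^sub>m i * H b c) * (E ^\<^sub>m i' * H b' c'))" by simp
  also have "\<dots> = tr (E ^\<^sub>m i' * (H b' c' * (F ^\<^sub>m i * H b c)))"
    by (subst tr_cyc) simp_all
  finally show ?thesis using tr_E_F_eq_0[of i' i] assms by simp
qed

lemma zeta_mod_mult: "\<zeta> powi (a * (x mod int d)) = \<zeta> powi (a * x)"
  by (simp only: mult.commute[of a] power_int_mult root_unity_powi_mod[OF zeta_pow_d d_pos])

lemma H_cong: "b mod int d = b' mod int d \<Longrightarrow> c mod int d = c' mod int d \<Longrightarrow> H b c = H b' c'"
  by (metis H_mod)

text \<open>The traces on \<open>M\<close> with the two exponents of \<open>K\<close> from the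
  R-matrices left free, as periodic functions for Fourier inversion. \<open>T\<close> and
  \<open>U\<close> are the values of \<open>W\<close> and \<open>V\<close> at the points that
  inversion selects.\<close>

definition "W i x y = tr (E ^\<^sub>m i * (H x 0 * (F ^\<^sub>m i * H (y + 1) (- (y + 1)))))"
definition "V i x y = tr (F ^\<^sub>m i * (H x (- x) * (E ^\<^sub>m i * H (y - 1) 1)))"

lemma W_mod: "W i (x mod int d) y = W i x y" "W i x (y mod int d) = W i x y"
proof -
  show "W i (x mod int d) y = W i x y" by (simp add: W_def H_mod)
  have "H (y mod int d + 1) (- (y mod int d + 1)) = H (y + 1) (- (y + 1))"
    by (rule H_cong) (metis mod_add_left_eq, metis mod_add_left_eq mod_minus_eq)
  then show "W i x (y mod int d) = W i x y" by (simp only: W_def)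
qed

lemma V_mod: "V i (x mod int d) y = V i x y" "V i x (y mod int d) = V i x y"
proof -
  have "H (x mod int d) (- (x mod int d)) = H x (- x)"
    by (rule H_cong) (simp, metis mod_minus_eq)
  then show "V i (x mod int d) y = V i x y" by (simp only: V_def)
  have "H (y mod int d - 1) 1 = H (y - 1) 1"
    by (rule H_cong) (metis mod_diff_left_eq, simp)
  then show "V i x (y mod int d) = V i x y" by (simp only: V_def)
qed

lemma T_W: "T s i a = W i (a - s) (a + int i)"
  by (simp add: T_def W_def)

lemma U_V: "U s i a = V i a (a - s - int i)"
  by (simp add: U_def V_def)

lemma tr_pivot:
  "tr (pivot d M * (R_left M i j * R_right d M i' k))
    = tr (E ^\<^sub>m i * (H (int j) 0 * (F ^\<^sub>m i' * H (int k + 1) (- (int k + 1)))))"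
proof -
  have "tr (pivot d M * (R_left M i j * R_right d M i' k))
      = tr (E ^\<^sub>m i * (H (int j) 0 * (H 0 (- int k) * (F ^\<^sub>m i' * (H (int k) 0 * H 1 (-1))))))"
    unfolding pivot_H R_left_H R_right_H by (subst tr_cyc) simp_all
  also have "\<dots> = tr (E ^\<^sub>m i * H (int j) 0 * (H 0 (- int k) * (F ^\<^sub>m i' * (H (int k) 0 * H 1 (-1)))))"
    by simp
  also have "\<dots> = tr (E ^\<^sub>m i * (H (int j) 0 * (F ^\<^sub>m i' * (H 0 (- int k) * (H (int k) 0 * H 1 (-1))))))"
    by (subst tr_HF_pow) simp_all
  also have "H 0 (- int k) * (H (int k) 0 * H 1 (-1)) = H (int k + 1) (- (int k + 1))"
    by (simp add: H_add)
  finally show ?thesis .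
qed

lemma tr_pivot_inv:
  "tr (R_right d M i k * R_left M i' j * pivot_inv d M)
    = tr (F ^\<^sub>m i * (H (int k) (- int k) * (E ^\<^sub>m i' * H (int j - 1) 1)))"
proof -
  have "tr (R_right d M i k * R_left M i' j * pivot_inv d M)
      = tr (1\<^sub>m n * (H 0 (- int k) * (F ^\<^sub>m i * (H (int k) 0 * (E ^\<^sub>m i' * (H (int j) 0 * H (-1) 1))))))"
    unfolding pivot_inv_H R_left_H R_right_H by simp
  also have "\<dots> = tr (F ^\<^sub>m i * ((H 0 (- int k) * H (int k) 0) * (E ^\<^sub>m i' * (H (int j) 0 * H (-1) 1))))"
    by (subst tr_HF_pow) simp_all
  finally show ?thesis by (simp only: H_add) simp
qed

section \<open>The matrix entries of the partial quantum traces\<close>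

lemma sum_R_index_diagonal:
  fixes h :: "nat \<Rightarrow> nat \<Rightarrow> nat \<Rightarrow> nat \<Rightarrow> nat \<Rightarrow> nat \<Rightarrow> complex"
  assumes "\<And>i j k i' j' k'. i \<noteq> i' \<Longrightarrow> i < d \<Longrightarrow> i' < d \<Longrightarrow> h i j k i' j' k' = 0"
  shows "(\<Sum>((i, j, k), (i', j', k'))\<in>R_index d \<times> R_index d. h i j k i' j' k')
    = (\<Sum>i<d. \<Sum>j<d. \<Sum>k<d. \<Sum>j'<d. \<Sum>k'<d. h i j k i j' k')"
proof -
  have "(\<Sum>((i, j, k), (i', j', k'))\<in>R_index d \<times> R_index d. h i j k i' j' k')
    = (\<Sum>i<d. \<Sum>j<d. \<Sum>k<d. \<Sum>i'<d. \<Sum>j'<d. \<Sum>k'<d. h i j k i' j' k')"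
    unfolding R_index_def sum.cartesian_product' by simp
  also have "\<dots> = (\<Sum>i<d. \<Sum>j<d. \<Sum>k<d. \<Sum>i'<d. if i' = i then \<Sum>j'<d. \<Sum>k'<d. h i j k i' j' k' else 0)"
    by (intro sum.cong refl) (auto simp: assms)
  finally show ?thesis by simp
qed

text \<open>What remains of the two R-matrix coefficients after inversion: at the selected point the
  quadratic exponent becomes \<open>- i (1 + s)\<close>, for both signs and independently of the
  weight.\<close>

definition "\<gamma> i = \<zeta> powi (- (int i * (1 + s))) / (qfact \<zeta> i * qfact \<zeta> i)"

lemma R_coeff_mult:
  "R_coeff d \<zeta> i j k * R_coeff d \<zeta> i j' k'
    = \<zeta> powi ((int i - int k) * (int i + int j) + (int i - int k') * (int i + int j') - int i * (int i + 1))
      / (of_nat d * of_nat d * (qfact \<zeta> i * qfact \<zeta> i))"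
proof -
  \<comment> \<open>Each coefficient contains \<open>int i * (int i + 1) div 2\<close>; evenness
    makes the two integer quotients add up to the full product.\<close>
  have "even (int i * (int i + 1))" by simp
  then have "int i * (int i + 1) = int i * (int i + 1) div 2 + int i * (int i + 1) div 2"
    by (metis dvd_div_mult_self mult_2_right)
  then have "\<zeta> powi ((int i - int k) * (int i + int j) - int i * (int i + 1) div 2)
      * \<zeta> powi ((int i - int k') * (int i + int j') - int i * (int i + 1) div 2)
    = \<zeta> powi ((int i - int k) * (int i + int j) + (int i - int k') * (int i + int j') - int i * (int i + 1))"
    unfolding zeta_add [symmetric] by (intro arg_cong[of _ _ "\<lambda>x. \<zeta> powi x"]) linarith
  then show ?thesis by (simp add: R_coeff_def)
qed

lemma R_carrier [simp]:
  "R_left M i j \<in> carrier_mat n n" "R_right d M i j \<in> carrier_mat n n"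
  "R_left L i j \<in> carrier_mat m m" "R_right d L i j \<in> carrier_mat m m"
  by (simp_all add: R_left_H R_right_H L_R_left L_R_right)

text \<open>The pivot acts on the factor \<open>M\<close> alone, and the partial trace of
  \<open>kron A B\<close> over \<open>M\<close> is \<open>tr B\<close> times \<open>A\<close>; the
  rest is linearity.\<close>

lemma qtrace_plus_entry_sum:
  assumes rc: "r < m" "c < m"
  shows "qtrace_plus_right d L M (braiding d \<zeta> M L * braiding d \<zeta> L M) $$ (r, c)
    = (\<Sum>((i, j, k), (i', j', k'))\<in>R_index d \<times> R_index d.
        R_coeff d \<zeta> i j k * R_coeff d \<zeta> i' j' k' * (R_right d L i k * R_left L i' j') $$ (r, c)
        * tr (pivot d M * (R_left M i j * R_right d M i' k')))"
proof -
  define P where "P = pivot d M"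
  have P: "P \<in> carrier_mat n n" by (simp add: P_def pivot_H)
  define A where "A = (\<lambda>((i :: nat, j :: nat, k :: nat), (i' :: nat, j' :: nat, k' :: nat)). R_right d L i k * R_left L i' j')"
  define B where "B = (\<lambda>((i :: nat, j :: nat, k :: nat), (i' :: nat, j' :: nat, k' :: nat)). R_left M i j * R_right d M i' k')"
  define x where "x = (\<lambda>((i :: nat, j :: nat, k :: nat), (i' :: nat, j' :: nat, k' :: nat)). R_coeff d \<zeta> i j k * R_coeff d \<zeta> i' j' k')"
  have A: "A u \<in> carrier_mat m m" and B: "B u \<in> carrier_mat n n" for u
    by (auto simp: A_def B_def split: prod.splits intro: mult_carrier_mat[of _ m m])
  let ?S = "R_index d \<times> R_index d"
  have "braiding d \<zeta> M L * braiding d \<zeta> L M = mat_sum (m * n) (m * n) (\<lambda>u. x u \<cdot>\<^sub>m kron (A u) (B u)) ?S"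
    using braiding_square[of d M L \<zeta>] unfolding L_sel(1)
    by (simp add: x_def A_def B_def case_prod_unfold)
  also have "kron (1\<^sub>m m) P * \<dots> = mat_sum (m * n) (m * n) (\<lambda>u. x u \<cdot>\<^sub>m kron (A u) (P * B u)) ?S"
  proof (subst mat_sum_mult_left[of _ "m * n"], safe intro!: mat_sum_cong)
    fix a b
    show "kron (1\<^sub>m m) P * (x (a, b) \<cdot>\<^sub>m kron (A (a, b)) (B (a, b))) = x (a, b) \<cdot>\<^sub>m kron (A (a, b)) (P * B (a, b))"
      using P A[of "(a, b)"] B[of "(a, b)"]
      by (simp add: mult_smult_distrib[of _ "m * n" "m * n" _ "m * n"] kron_mult[of _ m m _ n n _ m _ n]
          left_mult_one_mat[of _ m m])
  qed (use P A B in simp_all)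
  finally have "qtrace_plus_right d L M (braiding d \<zeta> M L * braiding d \<zeta> L M) $$ (r, c)
      = (\<Sum>q<n. mat_sum (m * n) (m * n) (\<lambda>u. x u \<cdot>\<^sub>m kron (A u) (P * B u)) ?S $$ (r * n + q, c * n + q))"
    using rc by (simp add: qtrace_plus_right_def ptrace_right_def L_sel(1) P_def)
  also have "\<dots> = (\<Sum>q<n. \<Sum>u\<in>?S. x u * kron (A u) (P * B u) $$ (r * n + q, c * n + q))"
  proof (rule sum.cong)
    fix q assume q: "q \<in> {..<n}"
    have less: "r' * n + q < m * n" if "r' < m" for r'
    proof -
      have "r' * n + q < Suc r' * n" using q by simp
      also have "\<dots> \<le> m * n" using that by (intro mult_right_mono) auto
      finally show ?thesis .
    qed
    have "kron (A u) (P * B u) \<in> carrier_mat (m * n) (m * n)" for u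
      using P A B by simp
    then have "dim_row (kron (A u) (P * B u)) = m * n" "dim_col (kron (A u) (P * B u)) = m * n" for u
      by blast+
    then show "mat_sum (m * n) (m * n) (\<lambda>u. x u \<cdot>\<^sub>m kron (A u) (P * B u)) ?S $$ (r * n + q, c * n + q)
        = (\<Sum>u\<in>?S. x u * kron (A u) (P * B u) $$ (r * n + q, c * n + q))"
      using less rc by (simp add: mat_sum_def)
  qed simp
  also have "\<dots> = (\<Sum>u\<in>?S. x u * (\<Sum>q<n. kron (A u) (P * B u) $$ (r * n + q, c * n + q)))"
    by (subst sum.swap) (simp add: sum_distrib_left)
  also have "\<dots> = (\<Sum>u\<in>?S. x u * (A u $$ (r, c) * tr (P * B u)))"
    using A B P rc by (simp add: ptrace_right_kron[of _ m _ n])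
  finally show ?thesis by (simp add: x_def A_def B_def P_def case_prod_unfold mult.assoc)
qed

lemma qtrace_minus_entry_sum:
  assumes rc: "r < m" "c < m"
  shows "qtrace_minus_left d M L (braiding d \<zeta> L M * braiding d \<zeta> M L) $$ (r, c)
    = (\<Sum>((i, j, k), (i', j', k'))\<in>R_index d \<times> R_index d.
        R_coeff d \<zeta> i j k * R_coeff d \<zeta> i' j' k' * (R_left L i j * R_right d L i' k') $$ (r, c)
        * tr (R_right d M i k * R_left M i' j' * pivot_inv d M))"
proof -
  define P where "P = pivot_inv d M"
  have P: "P \<in> carrier_mat n n" by (simp add: P_def pivot_inv_H)
  define A where "A = (\<lambda>((i :: nat, j :: nat, k :: nat), (i' :: nat, j' :: nat, k' :: nat)). R_left L i j * R_right d L i' k')"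
  define B where "B = (\<lambda>((i :: nat, j :: nat, k :: nat), (i' :: nat, j' :: nat, k' :: nat)). R_right d M i k * R_left M i' j')"
  define x where "x = (\<lambda>((i :: nat, j :: nat, k :: nat), (i' :: nat, j' :: nat, k' :: nat)). R_coeff d \<zeta> i j k * R_coeff d \<zeta> i' j' k')"
  have A: "A u \<in> carrier_mat m m" and B: "B u \<in> carrier_mat n n" for u
    by (auto simp: A_def B_def split: prod.splits intro: mult_carrier_mat[of _ m m])
  let ?S = "R_index d \<times> R_index d"
  have "braiding d \<zeta> L M * braiding d \<zeta> M L = mat_sum (n * m) (n * m) (\<lambda>u. x u \<cdot>\<^sub>m kron (B u) (A u)) ?S"
    using braiding_square[of d L M \<zeta>] unfolding L_sel(1)
    by (simp add: x_def A_def B_def case_prod_unfold)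
  then have "braiding d \<zeta> L M * braiding d \<zeta> M L * kron P (1\<^sub>m m)
      = mat_sum (n * m) (n * m) (\<lambda>u. x u \<cdot>\<^sub>m kron (B u) (A u)) ?S * kron P (1\<^sub>m m)"
    by simp
  also have "\<dots> = mat_sum (n * m) (n * m) (\<lambda>u. x u \<cdot>\<^sub>m kron (B u * P) (A u)) ?S"
  proof (subst mat_sum_mult_right[of _ _ "n * m"], safe intro!: mat_sum_cong)
    fix a b
    show "(x (a, b) \<cdot>\<^sub>m kron (B (a, b)) (A (a, b))) * kron P (1\<^sub>m m) = x (a, b) \<cdot>\<^sub>m kron (B (a, b) * P) (A (a, b))"
      using P A[of "(a, b)"] B[of "(a, b)"]
      by (simp add: mult_smult_assoc_mat[of _ "n * m" "n * m" _ "n * m"] kron_mult[of _ n n _ m m _ n _ m]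
          right_mult_one_mat[of _ m m])
  qed (use P A B in simp_all)
  finally have "qtrace_minus_left d M L (braiding d \<zeta> L M * braiding d \<zeta> M L) $$ (r, c)
      = (\<Sum>q<n. mat_sum (n * m) (n * m) (\<lambda>u. x u \<cdot>\<^sub>m kron (B u * P) (A u)) ?S $$ (q * m + r, q * m + c))"
    using rc by (simp add: qtrace_minus_left_def ptrace_left_def L_sel(1) P_def)
  also have "\<dots> = (\<Sum>q<n. \<Sum>u\<in>?S. x u * kron (B u * P) (A u) $$ (q * m + r, q * m + c))"
  proof (rule sum.cong)
    fix q assume q: "q \<in> {..<n}"
    have less: "q * m + r' < n * m" if "r' < m" for r'
    proof -
      have "q * m + r' < Suc q * m" using that by simp
      also have "\<dots> \<le> n * m" using q by (intro mult_right_mono) auto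
      finally show ?thesis .
    qed
    have "kron (B u * P) (A u) \<in> carrier_mat (n * m) (n * m)" for u
      using P A B by simp
    then have "dim_row (kron (B u * P) (A u)) = n * m" "dim_col (kron (B u * P) (A u)) = n * m" for u
      by blast+
    then show "mat_sum (n * m) (n * m) (\<lambda>u. x u \<cdot>\<^sub>m kron (B u * P) (A u)) ?S $$ (q * m + r, q * m + c)
        = (\<Sum>u\<in>?S. x u * kron (B u * P) (A u) $$ (q * m + r, q * m + c))"
      using less rc by (simp add: mat_sum_def)
  qed simp
  also have "\<dots> = (\<Sum>u\<in>?S. x u * (\<Sum>q<n. kron (B u * P) (A u) $$ (q * m + r, q * m + c)))"
    by (subst sum.swap) (simp add: sum_distrib_left)
  also have "\<dots> = (\<Sum>u\<in>?S. x u * (tr (B u * P) * A u $$ (r, c)))"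
    using A B P rc by (simp add: ptrace_left_kron[of _ n _ m])
  finally show ?thesis by (simp add: x_def A_def B_def P_def case_prod_unfold mult_ac)
qed

text \<open>The total exponent is linear in \<open>k\<close> and \<open>j'\<close>, which are absent
  from the trace on \<open>M\<close>. Summing over them selects \<open>j = wt c - s\<close> and
  \<open>k' = wt c + i\<close> modulo \<open>d\<close>, where the trace becomes
  \<open>T\<close>.\<close>

lemma qtrace_plus_entry:
  assumes rc: "r < m" "c < m"
  shows "qtrace_plus_right d L M (braiding d \<zeta> M L * braiding d \<zeta> L M) $$ (r, c)
    = (if r = c then \<Sum>i<d. \<gamma> i * \<Phi> (int c) i * T s i (wt c) else 0)"
proof -
  define w where "w = wt c"
  define D :: complex where "D = of_nat d * of_nat d"
  have D: "D \<noteq> 0" using d_pos by (simp add: D_def)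
  let ?h = "\<lambda>i j k i' j' k'. R_coeff d \<zeta> i j k * R_coeff d \<zeta> i' j' k' * (R_right d L i k * R_left L i' j') $$ (r, c)
        * tr (pivot d M * (R_left M i j * R_right d M i' k'))"
  have "qtrace_plus_right d L M (braiding d \<zeta> M L * braiding d \<zeta> L M) $$ (r, c)
      = (\<Sum>i<d. \<Sum>j<d. \<Sum>k<d. \<Sum>j'<d. \<Sum>k'<d. ?h i j k i j' k')"
    unfolding qtrace_plus_entry_sum[OF rc]
    by (rule sum_R_index_diagonal) (simp add: tr_pivot tr_E_F_eq_0)
  also have "\<dots> = (if r = c then \<Sum>i<d. \<gamma> i * \<Phi> (int c) i * T s i w else 0)"
  proof (cases "r = c")
    case True
    have "(\<Sum>j<d. \<Sum>k<d. \<Sum>j'<d. \<Sum>k'<d. ?h i j k i j' k') = \<gamma> i * \<Phi> (int c) i * T s i w" for i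
    proof -
      \<comment> \<open>The part of the exponent free of \<open>k\<close> and \<open>j'\<close>. It
        is periodic in both arguments and is sampled together with \<open>W\<close>.\<close>
      let ?e = "\<lambda>x y. \<zeta> powi (int i * int i + int i * x - int i * y - int i)"
      have h: "?h i j k i j' k' = \<Phi> (int c) i / (D * (qfact \<zeta> i * qfact \<zeta> i)) *
        (\<zeta> powi (int k * ((w - s) - int j) + int j' * ((w + int i) - int k')) * (?e (int j) (int k') * W i (int j) (int k')))"
        for j k j' k'
      proof -
        have "\<zeta> powi ((int i - int k) * (int i + int j) + (int i - int k') * (int i + int j') - int i * (int i + 1))
            * \<zeta> powi (int j' * w + int k * (w + int i - s))
          = \<zeta> powi (int k * ((w - s) - int j) + int j' * ((w + int i) - int k')) * ?e (int j) (int k')"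
          unfolding zeta_add [symmetric] by (rule arg_cong[of _ _ "\<lambda>x. \<zeta> powi x"]) (simp add: algebra_simps)
        then show ?thesis
          using True rc unfolding R_coeff_mult tr_pivot L_right_left[OF rc] W_def [symmetric] w_def [symmetric]
          by (simp add: D_def mult_ac)
      qed
      have per: "?e (x mod int d) y = ?e x y" "?e x (y mod int d) = ?e x y" for x y
        by (simp_all only: zeta_add zeta_diff zeta_mod_mult)
      have "(\<Sum>j<d. \<Sum>k<d. \<Sum>j'<d. \<Sum>k'<d. ?h i j k i j' k')
        = \<Phi> (int c) i / (D * (qfact \<zeta> i * qfact \<zeta> i)) * (\<Sum>j<d. \<Sum>k<d. \<Sum>j'<d. \<Sum>k'<d.
          \<zeta> powi (int k * ((w - s) - int j) + int j' * ((w + int i) - int k')) * (?e (int j) (int k') * W i (int j) (int k')))"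
        unfolding h by (simp only: sum_distrib_left)
      \<comment> \<open>Inversion wants each sampled exponent in front of its dual one; only the
        inner pair stands in the other order.\<close>
      also have "(\<Sum>j<d. \<Sum>k<d. \<Sum>j'<d. \<Sum>k'<d.
          \<zeta> powi (int k * ((w - s) - int j) + int j' * ((w + int i) - int k')) * (?e (int j) (int k') * W i (int j) (int k')))
        = (\<Sum>j<d. \<Sum>k<d. \<Sum>k'<d. \<Sum>j'<d.
          \<zeta> powi (int k * ((w - s) - int j) + int j' * ((w + int i) - int k')) * (?e (int j) (int k') * W i (int j) (int k')))"
        by (intro sum.cong refl sum.swap)
      also have "\<dots> = D * (?e (w - s) (w + int i) * W i (w - s) (w + int i))"
        unfolding D_def
        by (rule fourier_inversion_twice[OF primitive d_pos, of "\<lambda>x y. ?e x y * W i x y"])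
          (simp_all only: per W_mod)
      also have "?e (w - s) (w + int i) = \<zeta> powi (- (int i * (1 + s)))"
        by (rule arg_cong[of _ _ "\<lambda>x. \<zeta> powi x"]) (simp add: algebra_simps)
      finally show ?thesis using D by (simp add: \<gamma>_def T_W)
    qed
    then show ?thesis using True by simp
  qed (simp add: L_right_left[OF rc])
  finally show ?thesis by (simp add: w_def)
qed

text \<open>Here \<open>j\<close> and \<open>k'\<close> are absent from the trace on
  \<open>M\<close>, and inversion selects \<open>k = wt c\<close> and
  \<open>j' = wt c - s - i\<close> modulo \<open>d\<close>.\<close>

lemma qtrace_minus_entry:
  assumes rc: "r < m" "c < m"
  shows "qtrace_minus_left d M L (braiding d \<zeta> L M * braiding d \<zeta> M L) $$ (r, c)
    = (if r = c then \<Sum>i<d. \<gamma> i * \<Phi> (int c + int i) i * U s i (wt c) else 0)"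
proof -
  define w where "w = wt c"
  define D :: complex where "D = of_nat d * of_nat d"
  have D: "D \<noteq> 0" using d_pos by (simp add: D_def)
  let ?h = "\<lambda>i j k i' j' k'. R_coeff d \<zeta> i j k * R_coeff d \<zeta> i' j' k' * (R_left L i j * R_right d L i' k') $$ (r, c)
        * tr (R_right d M i k * R_left M i' j' * pivot_inv d M)"
  have "qtrace_minus_left d M L (braiding d \<zeta> L M * braiding d \<zeta> M L) $$ (r, c)
      = (\<Sum>i<d. \<Sum>j<d. \<Sum>k<d. \<Sum>j'<d. \<Sum>k'<d. ?h i j k i j' k')"
    unfolding qtrace_minus_entry_sum[OF rc]
    by (rule sum_R_index_diagonal) (simp add: tr_pivot_inv tr_F_E_eq_0)
  also have "\<dots> = (if r = c then \<Sum>i<d. \<gamma> i * \<Phi> (int c + int i) i * U s i w else 0)"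
  proof (cases "r = c")
    case True
    have "(\<Sum>j<d. \<Sum>k<d. \<Sum>j'<d. \<Sum>k'<d. ?h i j k i j' k') = \<gamma> i * \<Phi> (int c + int i) i * U s i w" for i
    proof -
      let ?e = "\<lambda>x y. \<zeta> powi (int i * int i - int i * x + int i * y - int i)"
      have h: "?h i j k i j' k' = \<Phi> (int c + int i) i / (D * (qfact \<zeta> i * qfact \<zeta> i)) *
        (\<zeta> powi (int j * (w - int k) + int k' * ((w - s - int i) - int j')) * (?e (int k) (int j') * V i (int k) (int j')))"
        for j k j' k'
      proof -
        have "\<zeta> powi ((int i - int k) * (int i + int j) + (int i - int k') * (int i + int j') - int i * (int i + 1))
            * \<zeta> powi (int j * (w - int i) + int k' * (w - s))
          = \<zeta> powi (int j * (w - int k) + int k' * ((w - s - int i) - int j')) * ?e (int k) (int j')"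
          unfolding zeta_add [symmetric] by (rule arg_cong[of _ _ "\<lambda>x. \<zeta> powi x"]) (simp add: algebra_simps)
        then show ?thesis
          using True rc unfolding R_coeff_mult tr_pivot_inv L_left_right[OF rc] V_def [symmetric] w_def [symmetric]
          by (simp add: D_def mult_ac)
      qed
      have per: "?e (x mod int d) y = ?e x y" "?e x (y mod int d) = ?e x y" for x y
        by (simp_all only: zeta_add zeta_diff zeta_mod_mult)
      have "(\<Sum>j<d. \<Sum>k<d. \<Sum>j'<d. \<Sum>k'<d. ?h i j k i j' k')
        = \<Phi> (int c + int i) i / (D * (qfact \<zeta> i * qfact \<zeta> i)) * (\<Sum>j<d. \<Sum>k<d. \<Sum>j'<d. \<Sum>k'<d.
          \<zeta> powi (int j * (w - int k) + int k' * ((w - s - int i) - int j')) * (?e (int k) (int j') * V i (int k) (int j')))"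
        unfolding h by (simp only: sum_distrib_left)
      also have "(\<Sum>j<d. \<Sum>k<d. \<Sum>j'<d. \<Sum>k'<d.
          \<zeta> powi (int j * (w - int k) + int k' * ((w - s - int i) - int j')) * (?e (int k) (int j') * V i (int k) (int j')))
        = (\<Sum>k<d. \<Sum>j<d. \<Sum>j'<d. \<Sum>k'<d.
          \<zeta> powi (int j * (w - int k) + int k' * ((w - s - int i) - int j')) * (?e (int k) (int j') * V i (int k) (int j')))"
        by (rule sum.swap)
      also have "\<dots> = D * (?e w (w - s - int i) * V i w (w - s - int i))"
        unfolding D_def
        by (rule fourier_inversion_twice[OF primitive d_pos, of "\<lambda>x y. ?e x y * V i x y"])
          (simp_all only: per V_mod)
      also have "?e w (w - s - int i) = \<zeta> powi (- (int i * (1 + s)))"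
        by (rule arg_cong[of _ _ "\<lambda>x. \<zeta> powi x"]) (simp add: algebra_simps)
      finally show ?thesis using D by (simp add: \<gamma>_def U_V)
    qed
    then show ?thesis using True by simp
  qed (simp add: L_left_right[OF rc])
  finally show ?thesis by (simp add: w_def)
qed

section \<open>Equality of neighbouring entries and their common value\<close>

lemma \<gamma>_Suc:
  assumes "Suc i < d"
  shows "\<gamma> (Suc i) * (qint \<zeta> (Suc i) * qint \<zeta> (Suc i)) = \<gamma> i * \<zeta> powi (- (1 + s))"
proof -
  have "- (int (Suc i) * (1 + s)) = - (int i * (1 + s)) + (- (1 + s))" by (simp add: algebra_simps)
  then have "\<zeta> powi (- (int (Suc i) * (1 + s))) = \<zeta> powi (- (int i * (1 + s))) * \<zeta> powi (- (1 + s))"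
    by (simp only: zeta_add)
  then show ?thesis
    using primitive_root_qint_nonzero[OF primitive, of "Suc i"] assms
    by (simp add: \<gamma>_def qfact_Suc divide_simps del: of_nat_Suc)
qed

lemma wt_Suc: "wt (Suc c) = wt c - 1"
  by (simp add: wt_def)

text \<open>\<open>\<phi>_diff\<close> on the simple module and \<open>T_diff\<close> on
  \<open>M\<close> contain the same difference of powers up to
  \<open>\<zeta> powi (- (1 + s))\<close>; the ratio of consecutive \<open>\<gamma>\<close> supplies
  this factor and absorbs both q-integers.\<close>

lemma plus_sum_Suc:
  assumes "Suc c < m"
  shows "(\<Sum>i<d. \<gamma> i * \<Phi> (int (Suc c)) i * T s i (wt (Suc c))) = (\<Sum>i<d. \<gamma> i * \<Phi> (int c) i * T s i (wt c))"
proof (rule sum_telescope_shift[OF d_pos])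
  show "\<Phi> (int (Suc c)) 0 = \<Phi> (int c) 0" by (simp add: \<Phi>_def)
  \<comment> \<open>The window runs from \<open>c\<close> down to \<open>c - d + 2\<close> and
    contains 0 because \<open>Suc c < m\<close> and \<open>m \<le> d\<close>.\<close>
  show "\<Phi> (int c) (d - 1) = 0" by (rule \<Phi>_eq_0[OF \<phi>_0]) (use assms m in auto)
  fix i assume i: "Suc i < d"
  define w where "w = wt c"
  define q where "q = qint \<zeta> (Suc i)"
  have q: "q \<noteq> 0" using primitive_root_qint_nonzero[OF primitive, of "Suc i"] i by (simp add: q_def)
  have diff: "\<Phi> (int (Suc c)) (Suc i) - \<Phi> (int c) (Suc i) = \<Phi> (int c) i * (q * (\<zeta> powi w - \<zeta> powi (s - w - int i)))"
  proof -
    have "\<Phi> (int c + 1) (Suc i) - \<Phi> (int c) (Suc i) = \<Phi> (int c) i * (\<phi> (int c + 1) - \<phi> (int c - int i))"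
      unfolding \<Phi>_Suc_shift \<Phi>_Suc[of "int c"] by (simp add: algebra_simps)
    moreover have "p + l - 1 - int c = w" "p + int c - int i = s - w - int i" "int (Suc c) = int c + 1"
      by (simp_all add: w_def wt_def s_def)
    ultimately show ?thesis unfolding \<phi>_diff by (simp only: q_def)
  qed
  have e: "\<zeta> powi (- (1 + s)) * (\<zeta> powi w - \<zeta> powi (s - w - int i)) = \<zeta> powi (w - s - 1) - \<zeta> powi (- w - int i - 1)"
    unfolding right_diff_distrib zeta_add [symmetric]
    by (intro arg_cong2[of _ _ _ _ "(-)"] arg_cong[of _ _ "\<lambda>x. \<zeta> powi x"]) simp_all
  have "q * q * (\<gamma> (Suc i) * (\<Phi> (int (Suc c)) (Suc i) - \<Phi> (int c) (Suc i)) * T s (Suc i) (w - 1))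
      = \<gamma> i * \<zeta> powi (- (1 + s)) * (\<Phi> (int c) i * (q * (\<zeta> powi w - \<zeta> powi (s - w - int i)))) * T s (Suc i) (w - 1)"
    unfolding diff \<gamma>_Suc[OF i, folded q_def, symmetric] by (simp add: mult_ac)
  also have "\<dots> = q * \<gamma> i * \<Phi> (int c) i * ((\<zeta> powi (w - s - 1) - \<zeta> powi (- w - int i - 1)) * T s (Suc i) (w - 1))"
    unfolding e [symmetric] by (simp add: mult_ac)
  also have "\<dots> = q * q * (\<gamma> i * \<Phi> (int c) i * (T s i w - T s i (w - 1)))"
    unfolding T_diff [symmetric] q_def [symmetric] by (simp add: mult_ac)
  finally show "\<gamma> (Suc i) * (\<Phi> (int (Suc c)) (Suc i) - \<Phi> (int c) (Suc i)) * T s (Suc i) (wt (Suc c))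
      = \<gamma> i * \<Phi> (int c) i * (T s i (wt c) - T s i (wt (Suc c)))"
    unfolding wt_Suc w_def [symmetric] using q by simp
qed

text \<open>Compared with the plus sign the roles are exchanged: the vector of index
  \<open>Suc c\<close> supplies the unprimed data and with them the boundary term.\<close>

lemma minus_sum_Suc:
  assumes "Suc c < m"
  shows "(\<Sum>i<d. \<gamma> i * \<Phi> (int c + int i) i * U s i (wt c))
    = (\<Sum>i<d. \<gamma> i * \<Phi> (int (Suc c) + int i) i * U s i (wt (Suc c)))"
proof (rule sum_telescope_shift[OF d_pos])
  show "\<Phi> (int c + int 0) 0 = \<Phi> (int (Suc c) + int 0) 0" by (simp add: \<Phi>_def)
  \<comment> \<open>The window runs from \<open>c + d\<close> down to \<open>c + 2\<close> and
    contains \<open>l\<close> because \<open>Suc c < m\<close> and \<open>m \<le> d\<close>.\<close>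
  show "\<Phi> (int (Suc c) + int (d - 1)) (d - 1) = 0" by (rule \<Phi>_eq_0[OF \<phi>_l]) (use assms m in auto)
  fix i assume i: "Suc i < d"
  define w where "w = wt c"
  define q where "q = qint \<zeta> (Suc i)"
  \<comment> \<open>The index reached from \<open>c\<close> by \<open>i + 1\<close> applications of
    \<open>F\<close>; all arguments of \<open>\<Phi>\<close> in this step are \<open>y\<close> or
    \<open>y + 1\<close>.\<close>
  define y where "y = int c + 1 + int i"
  have q: "q \<noteq> 0" using primitive_root_qint_nonzero[OF primitive, of "Suc i"] i by (simp add: q_def)
  have y: "int c + int (Suc i) = y" "int (Suc c) + int (Suc i) = y + 1" "int (Suc c) + int i = y"
    by (simp_all add: y_def)
  have diff: "\<Phi> y (Suc i) - \<Phi> (y + 1) (Suc i) = - \<Phi> y i * (q * (\<zeta> powi (w - 1 - int i) - \<zeta> powi (s - w + 1)))"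
  proof -
    have "\<Phi> y (Suc i) - \<Phi> (y + 1) (Suc i) = - \<Phi> y i * (\<phi> (y + 1) - \<phi> (y - int i))"
      unfolding \<Phi>_Suc_shift \<Phi>_Suc[of y] by (simp add: algebra_simps)
    moreover have "p + l - 1 - y = w - 1 - int i" "p + y - int i = s - w + 1"
      by (simp_all add: w_def wt_def s_def y_def)
    ultimately show ?thesis unfolding \<phi>_diff by (simp only: q_def)
  qed
  have e: "\<zeta> powi (- (1 + s)) * (\<zeta> powi (w - 1 - int i) - \<zeta> powi (s - w + 1)) = \<zeta> powi (w - s - int i - 2) - \<zeta> powi (- w)"
    unfolding right_diff_distrib zeta_add [symmetric]
    by (intro arg_cong2[of _ _ _ _ "(-)"] arg_cong[of _ _ "\<lambda>x. \<zeta> powi x"]) simp_all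
  have "q * q * (\<gamma> (Suc i) * (\<Phi> y (Suc i) - \<Phi> (y + 1) (Suc i)) * U s (Suc i) w)
      = \<gamma> i * \<zeta> powi (- (1 + s)) * (- \<Phi> y i * (q * (\<zeta> powi (w - 1 - int i) - \<zeta> powi (s - w + 1)))) * U s (Suc i) w"
    unfolding diff \<gamma>_Suc[OF i, folded q_def, symmetric] by (simp add: mult_ac)
  also have "\<dots> = - (q * \<gamma> i * \<Phi> y i * ((\<zeta> powi (w - s - int i - 2) - \<zeta> powi (- w)) * U s (Suc i) w))"
    unfolding e [symmetric] by (simp add: mult_ac)
  also have "\<dots> = q * q * (\<gamma> i * \<Phi> y i * (U s i (w - 1) - U s i w))"
    unfolding U_diff [symmetric] q_def [symmetric] by (simp add: algebra_simps)
  finally show "\<gamma> (Suc i) * (\<Phi> (int c + int (Suc i)) (Suc i) - \<Phi> (int (Suc c) + int (Suc i)) (Suc i)) * U s (Suc i) (wt c)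
      = \<gamma> i * \<Phi> (int (Suc c) + int i) i * (U s i (wt (Suc c)) - U s i (wt c))"
    unfolding wt_Suc w_def [symmetric] y using q by simp
qed

text \<open>The induction starts at the highest weight vector, whose window begins at the zero 0 of
  \<open>\<phi>\<close>. Its weight \<open>p + l - 1\<close> makes the exponent of \<open>K\<close>
  equal to \<open>2 * (p + l - 1) - s + 1 = l\<close>.\<close>

lemma plus_sum:
  assumes "c < m"
  shows "(\<Sum>i<d. \<gamma> i * \<Phi> (int c) i * T s i (wt c)) = chi_module d (- l, - p) M"
  using assms
proof (induction c)
  case 0
  have "\<Phi> (int 0) i = 0" if "i \<noteq> 0" for i by (rule \<Phi>_eq_0[OF \<phi>_0]) (use that in auto)
  then have "(\<Sum>i<d. \<gamma> i * \<Phi> (int 0) i * T s i (wt 0)) = (\<Sum>i<d. if i = 0 then \<gamma> 0 * \<Phi> 0 0 * T s 0 (wt 0) else 0)"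
    by (intro sum.cong) auto
  also have "\<dots> = T s 0 (p + l - 1)" using d_pos by (simp add: \<gamma>_def \<Phi>_def wt_def)
  also have "\<dots> = tr (H l (- (p + l)))"
    by (simp add: T_def H_add s_def)
  also have "\<dots> = tr (H (- l) (- p))"
    using trace_reflect[of l "- (p + l)"] l by simp
  finally show ?case by (simp add: chi_module_def H_def)
next
  case (Suc c)
  then show ?case using plus_sum_Suc by simp
qed

text \<open>The induction runs downwards from the lowest vector, of weight \<open>p\<close>, whose
  window ends at the zero \<open>l\<close> of \<open>\<phi>\<close>; there the exponent of
  \<open>K\<close> is \<open>2 * p - s - 1 = - l\<close>.\<close>

lemma minus_sum:
  assumes "c < m"
  shows "(\<Sum>i<d. \<gamma> i * \<Phi> (int c + int i) i * U s i (wt c)) = chi_module d (- l, 1 - p) M"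
proof -
  have "c \<le> m - 1" using assms by simp
  then show ?thesis
  proof (induction rule: inc_induct)
    case base
    have wt: "wt (m - 1) = p" using m by (simp add: wt_def of_nat_diff)
    have "\<Phi> (int (m - 1) + int i) i = 0" if "i \<noteq> 0" for i
      by (rule \<Phi>_eq_0[OF \<phi>_l]) (use that m in auto)
    then have "(\<Sum>i<d. \<gamma> i * \<Phi> (int (m - 1) + int i) i * U s i (wt (m - 1)))
        = (\<Sum>i<d. if i = 0 then \<gamma> 0 * \<Phi> (int (m - 1)) 0 * U s 0 (wt (m - 1)) else 0)"
      by (intro sum.cong) auto
    also have "\<dots> = U s 0 (wt (m - 1))"
      using d_pos by (simp add: \<gamma>_def \<Phi>_def)
    also have "\<dots> = tr (H (- l) (1 - p))"
      using wt by (simp add: U_def H_add s_def)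
    finally show ?case by (simp only: chi_module_def H_def prod.case)
  next
    case (step c)
    then show ?case using minus_sum_Suc[of c] by simp
  qed
qed

lemma s_plus_module_eq: "s_plus_module d \<zeta> (l, p) M = chi_module d (- l, - p) M"
proof -
  have "qtrace_plus_right d L M (braiding d \<zeta> M L * braiding d \<zeta> L M) = chi_module d (- l, - p) M \<cdot>\<^sub>m 1\<^sub>m m"
    by (rule eq_matI) (auto simp: qtrace_plus_entry plus_sum, auto simp: qtrace_plus_right_def ptrace_right_def L_sel(1))
  then show ?thesis using m by (simp add: s_plus_module_def scalar_of_smult_one)
qed

lemma s_minus_module_eq: "s_minus_module d \<zeta> (l, p) M = chi_module d (- l, 1 - p) M"
proof -
  have "qtrace_minus_left d M L (braiding d \<zeta> L M * braiding d \<zeta> M L) = chi_module d (- l, 1 - p) M \<cdot>\<^sub>m 1\<^sub>m m"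
    by (rule eq_matI) (auto simp: qtrace_minus_entry minus_sum, auto simp: qtrace_minus_left_def ptrace_left_def L_sel(1))
  then show ?thesis using m by (simp add: s_minus_module_def scalar_of_smult_one)
qed

end

section \<open>Maps on the Grothendieck ring\<close>

lemma mat_mult_vec_unit:
  fixes A :: "complex mat"
  assumes "A \<in> carrier_mat m n" "j < n"
  shows "A *\<^sub>v unit_vec n j = col A j"
  using assms col_mult2[of A m n "1\<^sub>m n" n j] right_mult_one_mat[of A m n] by simp

text \<open>The sequence splits linearly: \<open>S\<close> is a section of \<open>B\<close>,
  \<open>R\<close> a retraction of \<open>A\<close>, and \<open>A * R + S * B\<close> is the
  identity. Inserting it into the trace of \<open>X\<close> and rotating gives the result, with
  \<open>AX\<close> and \<open>BX\<close> as the only compatibility with the action.\<close>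

lemma mat_trace_short_exact:
  fixes A B X X' X'' :: "complex mat"
  assumes A: "A \<in> carrier_mat n n'" and B: "B \<in> carrier_mat n'' n"
    and X: "X \<in> carrier_mat n n" and X': "X' \<in> carrier_mat n' n'" and X'': "X'' \<in> carrier_mat n'' n''"
    and AX: "A * X' = X * A" and BX: "B * X = X'' * B"
    and inj: "inj_on (\<lambda>v. A *\<^sub>v v) (carrier_vec n')"
    and exact: "(\<lambda>v. A *\<^sub>v v) ` carrier_vec n' = {v \<in> carrier_vec n. B *\<^sub>v v = 0\<^sub>v n''}"
    and surj: "(\<lambda>v. B *\<^sub>v v) ` carrier_vec n = carrier_vec n''"
  shows "mat_trace X = mat_trace X' + mat_trace X''"
proof -
  \<comment> \<open>Solving \<open>P * R = Q\<close> column by column converts statements about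
    images of vectors into factorisations of matrices.\<close>
  have lift: "\<exists>R. R \<in> carrier_mat b c \<and> P * R = Q"
    if P: "P \<in> carrier_mat a b" and Q: "Q \<in> carrier_mat a c"
      and ex: "\<And>j. j < c \<Longrightarrow> \<exists>v\<in>carrier_vec b. P *\<^sub>v v = col Q j" for P Q :: "complex mat" and a b c
  proof -
    obtain f where f: "\<And>j. j < c \<Longrightarrow> f j \<in> carrier_vec b \<and> P *\<^sub>v f j = col Q j"
      using ex by metis
    define R where "R = mat b c (\<lambda>(i, j). f j $ i)"
    have R: "R \<in> carrier_mat b c" by (simp add: R_def)
    have "col (P * R) j = col Q j" if "j < c" for j
    proof -
      have "col R j = f j" using f[OF that] that by (intro eq_vecI) (auto simp: R_def)
      then show ?thesis using f[OF that] that R P by (simp add: col_mult2[of _ a b _ c])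
    qed
    then have "P * R = Q" using P Q R by (intro mat_col_eqI) auto
    then show ?thesis using R by blast
  qed
  have "\<exists>S. S \<in> carrier_mat n n'' \<and> B * S = 1\<^sub>m n''"
  proof (rule lift[OF B])
    fix j assume "j < n''"
    then have "col (1\<^sub>m n'') j \<in> (\<lambda>v. B *\<^sub>v v) ` carrier_vec n" unfolding surj by simp
    then show "\<exists>v\<in>carrier_vec n. B *\<^sub>v v = col (1\<^sub>m n'') j" by (metis imageE)
  qed simp
  then obtain S where S: "S \<in> carrier_mat n n''" and BS: "B * S = 1\<^sub>m n''" by blast
  have SB: "S * B \<in> carrier_mat n n" using S B by simp
  \<comment> \<open>The projection onto the kernel of \<open>B\<close> along the image of
    \<open>S\<close>; by exactness its columns lie in the image of \<open>A\<close>.\<close>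
  define Q where "Q = 1\<^sub>m n - S * B"
  have Q: "Q \<in> carrier_mat n n" using SB by (simp add: Q_def minus_carrier_mat)
  have BQ: "B * Q = 0\<^sub>m n'' n"
  proof -
    have "B * Q = B * 1\<^sub>m n - B * (S * B)"
      unfolding Q_def by (rule mult_minus_distrib_mat[OF B _ SB]) simp
    also have "B * (S * B) = B * S * B" using B S by (simp add: assoc_mult_mat[of _ n'' n _ n'' _ n])
    finally show ?thesis using B BS by simp
  qed
  have "\<exists>R. R \<in> carrier_mat n' n \<and> A * R = Q"
  proof (rule lift[OF A Q])
    fix j assume j: "j < n"
    have "B *\<^sub>v col Q j = col (B * Q) j" using B Q j by (simp add: col_mult2[of _ n'' n _ n])
    also have "\<dots> = 0\<^sub>v n''" unfolding BQ using j by simp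
    finally have "col Q j \<in> (\<lambda>v. A *\<^sub>v v) ` carrier_vec n'" unfolding exact using Q j by auto
    then show "\<exists>v\<in>carrier_vec n'. A *\<^sub>v v = col Q j" by (metis imageE)
  qed
  then obtain R where R: "R \<in> carrier_mat n' n" and AR: "A * R = Q" by blast
  have BA: "B * A = 0\<^sub>m n'' n'"
  proof (rule mat_col_eqI)
    fix j assume "j < dim_col (0\<^sub>m n'' n' :: complex mat)"
    then have j: "j < n'" by simp
    have "A *\<^sub>v unit_vec n' j \<in> {v \<in> carrier_vec n. B *\<^sub>v v = 0\<^sub>v n''}"
      unfolding exact [symmetric] by simp
    then have "B *\<^sub>v col A j = 0\<^sub>v n''" using mat_mult_vec_unit[OF A j] by simp
    then show "col (B * A) j = col (0\<^sub>m n'' n') j" using A B j by (simp add: col_mult2[of _ n'' n _ n'])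
  qed (use A B in auto)
  have RA: "R * A = 1\<^sub>m n'"
  proof (rule mat_col_eqI)
    fix j assume "j < dim_col (1\<^sub>m n' :: complex mat)"
    then have j: "j < n'" by simp
    have "A * (R * A) = Q * A" using A R AR by (simp add: assoc_mult_mat[of _ n n' _ n _ n', symmetric])
    also have "\<dots> = 1\<^sub>m n * A - S * B * A" unfolding Q_def by (rule minus_mult_distrib_mat[OF _ SB A]) simp
    also have "S * B * A = S * (B * A)" using S B A by (simp add: assoc_mult_mat[of _ n n'' _ n _ n'])
    finally have eq: "A * (R * A) = A" using A S BA by auto
    have "A *\<^sub>v col (R * A) j = col (A * (R * A)) j" using A R j by (simp add: col_mult2[of _ n n' _ n'])
    also have "\<dots> = A *\<^sub>v unit_vec n' j" unfolding eq using mat_mult_vec_unit[OF A j] by simp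
    finally have "col (R * A) j = unit_vec n' j"
      using inj A R j by (auto simp: inj_on_def)
    then show "col (R * A) j = col (1\<^sub>m n') j" using j by simp
  qed (use A R in auto)
  have "mat_trace X = mat_trace (X * (A * R)) + mat_trace (X * (S * B))"
  proof -
    have "1\<^sub>m n = A * R + S * B" unfolding AR Q_def using SB by (intro eq_matI) auto
    then have "X = X * (A * R + S * B)" using X by (metis right_mult_one_mat)
    also have "\<dots> = X * (A * R) + X * (S * B)"
      by (rule mult_add_distrib_mat[OF X _ SB]) (use A R in simp)
    finally have "mat_trace X = mat_trace (X * (A * R) + X * (S * B))" by simp
    moreover have "X * (A * R) \<in> carrier_mat n n" "X * (S * B) \<in> carrier_mat n n"
      by (rule mult_carrier_mat[OF X mult_carrier_mat[OF A R]], rule mult_carrier_mat[OF X SB])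
    ultimately show ?thesis by (simp only: mat_trace_add)
  qed
  also have "mat_trace (X * (A * R)) = mat_trace X'"
  proof -
    have "X * (A * R) = A * (X' * R)"
      by (simp only: assoc_mult_mat[OF X A R, symmetric] AX [symmetric] assoc_mult_mat[OF A X' R])
    then have "mat_trace (X * (A * R)) = mat_trace (X' * R * A)"
      using mat_trace_comm[OF A, of "X' * R"] X' R by simp
    also have "X' * R * A = X'" using X' R A RA by (simp add: assoc_mult_mat[of _ n' n' _ n _ n'])
    finally show ?thesis .
  qed
  also have "mat_trace (X * (S * B)) = mat_trace X''"
  proof -
    have "mat_trace (X * (S * B)) = mat_trace (X * S * B)"
      using X S B by (simp add: assoc_mult_mat[of _ n n _ n'' _ n])
    also have "\<dots> = mat_trace (B * (X * S))"
      using mat_trace_comm[OF _ B, of "X * S"] X S by simp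
    also have "B * (X * S) = X'' * (B * S)"
      by (simp only: assoc_mult_mat[OF B X S, symmetric] BX assoc_mult_mat[OF X'' B S])
    finally show ?thesis using BS X'' by simp
  qed
  finally show ?thesis .
qed

lemma pow_mat_intertwine:
  assumes "A \<in> carrier_mat n n'" "X \<in> carrier_mat n n" "X' \<in> carrier_mat n' n'" "A * X' = X * A"
  shows "A * X' ^\<^sub>m k = (X :: complex mat) ^\<^sub>m k * A"
proof (induction k)
  case (Suc k)
  have "A * X' ^\<^sub>m Suc k = A * X' ^\<^sub>m k * X'"
    using assms by (simp add: assoc_mult_mat[of _ n n' _ n' _ n'])
  also have "\<dots> = X ^\<^sub>m k * (A * X')"
    unfolding Suc using assms by (simp add: assoc_mult_mat[of _ n n _ n' _ n'])
  also have "\<dots> = X ^\<^sub>m Suc k * A"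
    unfolding assms(4) using assms by (simp add: assoc_mult_mat[of _ n n _ n _ n'])
  finally show ?case .
qed (use assms in auto)

lemma chi_module_short_exact:
  assumes "db_short_exact d \<zeta> M' M M''"
  shows "chi_module d ij M = chi_module d ij M' + chi_module d ij M''"
proof -
  obtain i j where ij: "ij = (i, j)" by fastforce
  obtain A B where M: "M' \<in> db_modules d \<zeta>" "M \<in> db_modules d \<zeta>" "M'' \<in> db_modules d \<zeta>"
    and A: "db_hom M' M A" and B: "db_hom M M'' B"
    and exact: "inj_on (\<lambda>v. A *\<^sub>v v) (carrier_vec (mdim M'))"
      "(\<lambda>v. A *\<^sub>v v) ` carrier_vec (mdim M') = {v \<in> carrier_vec (mdim M). B *\<^sub>v v = 0\<^sub>v (mdim M'')}"
      "(\<lambda>v. B *\<^sub>v v) ` carrier_vec (mdim M) = carrier_vec (mdim M'')"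
    using assms unfolding db_short_exact_def by blast
  define X where "X = (\<lambda>N :: db_module. zpow d (actK N) i * zpow d (actZ N) j)"
  have carr: "actK N \<in> carrier_mat (mdim N) (mdim N)" "actZ N \<in> carrier_mat (mdim N) (mdim N)"
    if "N \<in> db_modules d \<zeta>" for N
    using that by (auto simp: db_modules_def Let_def)
  have X: "X N \<in> carrier_mat (mdim N) (mdim N)" if "N \<in> db_modules d \<zeta>" for N
    unfolding X_def using carr[OF that] by (intro mult_carrier_mat[of _ _ "mdim N"] zpow_carrier)
  have intertwine: "C * X N = X N' * C"
    if N: "N \<in> db_modules d \<zeta>" "N' \<in> db_modules d \<zeta>" and C: "db_hom N N' C" for N N' C
  proof -
    note c = carr[OF N(1)] carr[OF N(2)]
    have C': "C \<in> carrier_mat (mdim N') (mdim N)" using C by (simp add: db_hom_def)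
    have K: "C * zpow d (actK N) i = zpow d (actK N') i * C" and Z: "C * zpow d (actZ N) j = zpow d (actZ N') j * C"
      unfolding zpow_def using C by (auto intro!: pow_mat_intertwine[OF C'] c simp: db_hom_def)
    have z: "zpow d (actK N) i \<in> carrier_mat (mdim N) (mdim N)" "zpow d (actZ N) j \<in> carrier_mat (mdim N) (mdim N)"
      "zpow d (actK N') i \<in> carrier_mat (mdim N') (mdim N')" "zpow d (actZ N') j \<in> carrier_mat (mdim N') (mdim N')"
      using c by simp_all
    have "C * X N = zpow d (actK N') i * C * zpow d (actZ N) j"
      unfolding X_def K [symmetric] by (rule assoc_mult_mat[OF C' z(1,2), symmetric])
    also have "\<dots> = zpow d (actK N') i * (zpow d (actZ N') j * C)"
      unfolding Z [symmetric] by (rule assoc_mult_mat[OF z(3) C' z(2)])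
    also have "\<dots> = X N' * C"
      unfolding X_def by (rule assoc_mult_mat[OF z(3,4) C', symmetric])
    finally show ?thesis .
  qed
  have "mat_trace (X M) = mat_trace (X M') + mat_trace (X M'')"
  proof (rule mat_trace_short_exact[OF _ _ X X X _ _ exact])
    show "A \<in> carrier_mat (mdim M) (mdim M')" "B \<in> carrier_mat (mdim M'') (mdim M)"
      using A B by (simp_all add: db_hom_def)
    show "A * X M' = X M * A" "B * X M = X M'' * B" using intertwine M A B by blast+
  qed (rule M)+
  then show ?thesis by (simp add: chi_module_def ij X_def)
qed

section \<open>Evaluation of formal sums of modules\<close>

lemma frag_eval_eq_sum:
  assumes "finite S" "Poly_Mapping.keys a \<subseteq> S"
  shows "frag_eval \<phi> a = (\<Sum>M\<in>S. of_int (Poly_Mapping.lookup a M) * \<phi> M)"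
  unfolding frag_eval_def
  by (rule sum.mono_neutral_left) (use assms in \<open>auto simp: in_keys_iff\<close>)

lemma frag_eval_add: "frag_eval \<phi> (a + b) = frag_eval \<phi> a + frag_eval \<phi> b"
proof -
  let ?S = "Poly_Mapping.keys a \<union> Poly_Mapping.keys b"
  have "frag_eval \<phi> (a + b) = (\<Sum>M\<in>?S. of_int (Poly_Mapping.lookup (a + b) M) * \<phi> M)"
    by (rule frag_eval_eq_sum) (auto dest: subsetD[OF keys_add])
  then show ?thesis
    by (simp add: frag_eval_eq_sum[of ?S] lookup_add distrib_right sum.distrib)
qed

lemma frag_eval_minus: "frag_eval \<phi> (- a) = - frag_eval \<phi> a"
  by (simp add: frag_eval_def sum_negf keys_minus)

lemma frag_eval_diff: "frag_eval \<phi> (a - b) = frag_eval \<phi> a - frag_eval \<phi> b"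
  using frag_eval_add[of \<phi> a "- b"] by (simp add: frag_eval_minus)

lemma frag_eval_of: "frag_eval \<phi> (frag_of M) = \<phi> M"
  by (simp add: frag_eval_def)

lemma frag_eval_cong:
  "(\<And>M. M \<in> Poly_Mapping.keys a \<Longrightarrow> \<phi> M = \<psi> M) \<Longrightarrow> frag_eval \<phi> a = frag_eval \<psi> a"
  by (simp add: frag_eval_def)

text \<open>The support is tracked along with the value because two functions will later be known to
  agree on \<open>db_modules d \<zeta>\<close> only.\<close>

lemma Gr_relations_props:
  assumes "a \<in> Gr_relations d \<zeta>"
    and additive: "\<And>M' M M''. db_short_exact d \<zeta> M' M M'' \<Longrightarrow> \<phi> M = \<phi> M' + \<phi> M''"
  shows "Poly_Mapping.keys a \<subseteq> db_modules d \<zeta> \<and> frag_eval \<phi> a = 0"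
proof -
  have incl: "Poly_Mapping.keys h \<subseteq> db_modules d \<zeta> \<and> frag_eval \<phi> h = 0"
    if h_in: "h \<in> {frag_of M - frag_of M' - frag_of M'' | M' M M''. db_short_exact d \<zeta> M' M M''}" for h
  proof -
    obtain M' M M'' where h: "h = frag_of M - frag_of M' - frag_of M''" and ex: "db_short_exact d \<zeta> M' M M''"
      using h_in by blast
    have "Poly_Mapping.keys h \<subseteq> {M, M', M''}"
      unfolding h using keys_diff[of "frag_of M - frag_of M'" "frag_of M''"] keys_diff[of "frag_of M" "frag_of M'"]
      by auto
    then show ?thesis
      using ex additive[OF ex] by (auto simp: db_short_exact_def h frag_eval_diff frag_eval_of)
  qed
  show ?thesis using assms(1) unfolding Gr_relations_def
  proof (induction rule: generate.induct)
    case one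
    show ?case by (simp add: frag_eval_def)
  next
    case (inv h)
    then show ?case using incl[OF inv] by (simp add: frag_eval_minus keys_minus)
  next
    case (eng h1 h2)
    then show ?case using keys_add[of h1 h2] by (auto simp: frag_eval_add)
  qed (rule incl)
qed

lemma Gr_carrier_props:
  assumes "X \<in> carrier (Gr d \<zeta>)"
    and "\<And>M' M M''. db_short_exact d \<zeta> M' M M'' \<Longrightarrow> \<phi> M = \<phi> M' + \<phi> M''"
  shows "\<exists>c. \<forall>a\<in>X. Poly_Mapping.keys a \<subseteq> db_modules d \<zeta> \<and> frag_eval \<phi> a = c"
proof -
  obtain x where x: "Poly_Mapping.keys x \<subseteq> db_modules d \<zeta>"
    and X: "X = Gr_relations d \<zeta> #>\<^bsub>free_Abelian_group (db_modules d \<zeta>)\<^esub> x"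
    using assms(1) by (auto simp: Gr_def Let_def FactGroup_def RCOSETS_def)
  have "Poly_Mapping.keys a \<subseteq> db_modules d \<zeta> \<and> frag_eval \<phi> a = frag_eval \<phi> x" if a: "a \<in> X" for a
  proof -
    obtain h where "h \<in> Gr_relations d \<zeta>" "a = h + x" using a by (auto simp: X r_coset_def)
    then show ?thesis
      using Gr_relations_props[of h d \<zeta> \<phi>] assms(2) x keys_add[of h x] by (auto simp: frag_eval_add)
  qed
  then show ?thesis by blast
qed

text \<open>Additivity is checked for \<open>\<psi>\<close>, which will be a character, and passes
  to \<open>\<phi>\<close>: elements of a coset are supported on modules, where the two agree. This
  is how the scalars are seen to be well defined on the Grothendieck ring.\<close>

lemma Gr_map_eqI:
  assumes eq: "\<And>M. M \<in> db_modules d \<zeta> \<Longrightarrow> \<phi> M = \<psi> M"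
    and additive: "\<And>M' M M''. db_short_exact d \<zeta> M' M M'' \<Longrightarrow> \<psi> M = \<psi> M' + \<psi> M''"
  shows "Gr_well_defined d \<zeta> \<phi> \<and> Gr_map d \<zeta> \<phi> = Gr_map d \<zeta> \<psi>"
proof -
  have *: "frag_eval \<phi> a = frag_eval \<psi> a" if "X \<in> carrier (Gr d \<zeta>)" "a \<in> X" for X a
    using Gr_carrier_props[OF that(1), of \<psi>] additive that(2) eq by (intro frag_eval_cong) blast
  have "Gr_well_defined d \<zeta> \<phi>"
    unfolding Gr_well_defined_def using Gr_carrier_props[of _ d \<zeta> \<psi>] additive * by metis
  moreover have "Gr_map d \<zeta> \<phi> = Gr_map d \<zeta> \<psi>"
    unfolding Gr_map_def by (rule restrict_ext) (simp add: * cong: ball_cong)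
  ultimately show ?thesis ..
qed

theorem theorem6p4:
  fixes d :: nat and \<zeta> :: complex and lam :: "int \<times> int"
  assumes "d \<ge> 2"
    and "primitive_root_unity d \<zeta>"
    and "lam \<in> Lambda d"
  shows "Gr_well_defined d \<zeta> (s_plus_module d \<zeta> lam) \<and>
         Gr_well_defined d \<zeta> (s_minus_module d \<zeta> lam) \<and>
         s_plus d \<zeta> lam = chi d \<zeta> (- lam) \<and>
         s_minus d \<zeta> lam = chi d \<zeta> ((0, 1) - lam)"
proof -
  obtain l p where lam: "lam = (l, p)" "1 \<le> l" "l \<le> int d"
    using assms(3) by (auto simp: Lambda_def)
  have "s_plus_module d \<zeta> lam M = chi_module d (- lam) M \<and> s_minus_module d \<zeta> lam M = chi_module d ((0, 1) - lam) M"
    if "M \<in> db_modules d \<zeta>" for M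
  proof -
    interpret db_rep_simple d \<zeta> M l p
      by unfold_locales (use assms that lam in auto)
    show ?thesis using s_plus_module_eq s_minus_module_eq by (simp add: lam)
  qed
  then show ?thesis
    unfolding s_plus_def s_minus_def chi_def
    using Gr_map_eqI[of d \<zeta> "s_plus_module d \<zeta> lam" "chi_module d (- lam)"]
      Gr_map_eqI[of d \<zeta> "s_minus_module d \<zeta> lam" "chi_module d ((0, 1) - lam)"]
      chi_module_short_exact by blast
qed

end
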